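(* Let $(\Pi,\Sigma)$ be a Coxeter system, $Q=(\sigma_1,\ldots,\sigma_m)$ a word in $\Sigma$, and $\pi\in\Pi$. Let $\Delta=\Delta(Q,\pi)$ be the subword complex, let $\Bbbk$ be a field, and for each reduced subword $D\subseteq Q$ let $\mathrm{abs}(D)\subseteq Q$ be the set of absorbable reflections. Then the $K$-polynomial of $\Bbbk[\Delta]$ is $$\mathcal K(\Bbbk[\Delta];\mathbf z)=\sum_{\text{facets } Q\smallsetminus D\text{ of }\Delta}(\mathbf 1-\mathbf z)^D\,\mathbf z^{\mathrm{abs}(D)},$$ where $(\mathbf 1-\mathbf z)^D=\prod_{\sigma_i\in D}(1-z_i)$ and $\mathbf z^{\mathrm{abs}(D)}=\prod_{\sigma_i\in\mathrm{abs}(D)}z_i$.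
   Context: Let $(\Pi,\Sigma)$ be a Coxeter system: $\Pi$ is a Coxeter group with set $\Sigma$ of simple reflections, and $\mathrm{length}$ is the length function with respect to $\Sigma$. A word of size $m$ is an ordered sequence $Q=(\sigma_1,\ldots,\sigma_m)$ of elements of $\Sigma$ (not necessarily a reduced expression). A subword $P$ of $Q$ is an ordered subsequence, remembered together with its positions in $Q$; thus subwords correspond to subsets of $\{1,\ldots,m\}$, "$\sigma_i\in P$" means that position $i$ belongs to $P$, and set operations on subwords are performed on positions. $P$ represents $\pi\in\Pi$ if the ordered product of the simple reflections in $P$ is a reduced decomposition of $\pi$; $P$ contains $\pi$ if some subsequence of $P$ represents $\pi$. A subword is reduced if it represents some element of $\Pi$. The subword complex $\Delta(Q,\pi)$ is the simplicial complex whose faces are the subwords $Q\smallsetminus P$ whose complements $P$ contain $\pi$; faces are regarded as subsets of $\{1,\ldots,m\}$. Its facets are the $Q\smallsetminus D$ with $D$ representing $\pi$. Demazure product: for $\tau\in\Pi$ and $\sigma\in\Sigma$ put $\tau*\sigma=\tau\sigma$ if $\mathrm{length}(\tau\sigma)>\mathrm{length}(\tau)$ and $\tau*\sigma=\tau$ if $\mathrm{length}(\tau\sigma)<\mathrm{length}(\tau)$. The Demazure product of a word $P=(\tau_1,\ldots,\tau_k)$ is $\delta(P)=(\cdots((1*\tau_1)*\tau_2)\cdots)*\tau_k$, where $1$ is the identity of $\Pi$. Given a reduced subword $D\subseteq Q$, a reflection $\sigma_i\in Q\smallsetminus D$ is absorbable if the word $T=D\cup\sigma_i$ in $Q$ satisfies: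 (i) $\delta(T)=\delta(D)$, and (ii) the unique reflection $\sigma_j\in D$ with $\delta(T\smallsetminus\sigma_j)=\delta(D)$ has index $j<i$. (When (i) holds, such a $\sigma_j\in D$ exists and is unique.) Let $\Bbbk[\mathbf z]=\Bbbk[z_1,\ldots,z_m]$. The Stanley--Reisner ideal of $\Delta$ is $I_\Delta=\langle\prod_{i\in D}z_i\mid D\subseteq\{1,\dots,m\},\ D\notin\Delta\rangle$, and $\Bbbk[\Delta]=\Bbbk[\mathbf z]/I_\Delta$. Its Hilbert series $H(\Bbbk[\Delta];\mathbf z)$ is the sum of all monomials of $\Bbbk[\mathbf z]$ lying outside $I_\Delta$; the $K$-polynomial (Hilbert numerator) $\mathcal K(\Bbbk[\Delta];\mathbf z)$ is the polynomial defined by $H(\Bbbk[\Delta];\mathbf z)=\mathcal K(\Bbbk[\Delta];\mathbf z)/\prod_{i=1}^m(1-z_i)$. *)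

theory Defs
  imports
    "HOL-Algebra.Generated_Groups"
    "HOL-Algebra.Ideal"
    "HOL-Library.Poly_Mapping"
begin

section \<open>Coxeter systems\<close>

definition word_prod :: "('a, 'b) monoid_scheme \<Rightarrow> 'a list \<Rightarrow> 'a" where
  "word_prod G w = foldr (mult G) w (one G)"

text \<open>
  The value 0 of a Coxeter matrix encodes the entry infinity, that is, no relation between
  the two generators.
\<close>

definition coxeter_matrix :: "'a set \<Rightarrow> ('a \<Rightarrow> 'a \<Rightarrow> nat) \<Rightarrow> bool" where
  "coxeter_matrix S M \<longleftrightarrow>
     (\<forall>s\<in>S. M s s = 1) \<and> (\<forall>s\<in>S. \<forall>t\<in>S. M s t = M t s \<and> (s \<noteq> t \<longrightarrow> M s t \<noteq> 1))"

text \<open>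
  Deletion of one relator \<open>(s t)\<^sup>M\<^sup>(\<^sup>s\<^sup>,\<^sup>t\<^sup>)\<close> from a word in \<open>S\<close>.  The relators with
  \<open>s = t\<close> are the words \<open>s s\<close>, so every generator is its own inverse and words without
  formal inverses suffice for the presentation.
\<close>

definition relator_step :: "'a set \<Rightarrow> ('a \<Rightarrow> 'a \<Rightarrow> nat) \<Rightarrow> 'a list \<Rightarrow> 'a list \<Rightarrow> bool" where
  "relator_step S M v w \<longleftrightarrow>
     (\<exists>x y s t. set x \<subseteq> S \<and> set y \<subseteq> S \<and> s \<in> S \<and> t \<in> S \<and>
        v = x @ concat (replicate (M s t) [s, t]) @ y \<and> w = x @ y)"

text \<open>
  The last condition says that \<open>G\<close> is presented by the generators \<open>S\<close> and the relations
  \<open>(s t)\<^sup>M\<^sup>(\<^sup>s\<^sup>,\<^sup>t\<^sup>) = 1\<close>.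
\<close>

definition coxeter_system :: "('a, 'b) monoid_scheme \<Rightarrow> 'a set \<Rightarrow> bool" where
  "coxeter_system G S \<longleftrightarrow>
     group G \<and> S \<subseteq> carrier G \<and> generate G S = carrier G \<and>
     (\<exists>M. coxeter_matrix S M \<and>
        (\<forall>v w. set v \<subseteq> S \<longrightarrow> set w \<subseteq> S \<longrightarrow>
           (word_prod G v = word_prod G w \<longleftrightarrow> equivclp (relator_step S M) v w)))"

definition cox_length :: "('a, 'b) monoid_scheme \<Rightarrow> 'a set \<Rightarrow> 'a \<Rightarrow> nat" where
  "cox_length G S g = (LEAST n. \<exists>w. set w \<subseteq> S \<and> word_prod G w = g \<and> length w = n)"


section \<open>Subword complexes\<close>

text \<open>
  A word \<open>Q\<close> is a list.  Its positions are numbered from 0, so they are the elements of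
  \<open>{..<length Q}\<close>.  A subword of \<open>Q\<close> is a set of positions, and \<open>nths Q P\<close> is the word
  spelled by the subword \<open>P\<close>.
\<close>

definition represents ::
  "('a, 'b) monoid_scheme \<Rightarrow> 'a set \<Rightarrow> 'a list \<Rightarrow> nat set \<Rightarrow> 'a \<Rightarrow> bool" where
  "represents G S Q P g \<longleftrightarrow>
     P \<subseteq> {..<length Q} \<and> word_prod G (nths Q P) = g \<and> length (nths Q P) = cox_length G S g"

definition contains ::
  "('a, 'b) monoid_scheme \<Rightarrow> 'a set \<Rightarrow> 'a list \<Rightarrow> nat set \<Rightarrow> 'a \<Rightarrow> bool" where
  "contains G S Q P g \<longleftrightarrow> P \<subseteq> {..<length Q} \<and> (\<exists>P'\<subseteq>P. represents G S Q P' g)"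

definition reduced_subword ::
  "('a, 'b) monoid_scheme \<Rightarrow> 'a set \<Rightarrow> 'a list \<Rightarrow> nat set \<Rightarrow> bool" where
  "reduced_subword G S Q P \<longleftrightarrow> (\<exists>g\<in>carrier G. represents G S Q P g)"

definition subword_complex ::
  "('a, 'b) monoid_scheme \<Rightarrow> 'a set \<Rightarrow> 'a list \<Rightarrow> 'a \<Rightarrow> nat set set" where
  "subword_complex G S Q g = {{..<length Q} - P | P. contains G S Q P g}"

definition facets :: "nat set set \<Rightarrow> nat set set" where
  "facets \<Delta> = {F \<in> \<Delta>. \<forall>F'\<in>\<Delta>. F \<subseteq> F' \<longrightarrow> F' = F}"

definition demazure_step :: "('a, 'b) monoid_scheme \<Rightarrow> 'a set \<Rightarrow> 'a \<Rightarrow> 'a \<Rightarrow> 'a" where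
  "demazure_step G S g s =
     (if cox_length G S (g \<otimes>\<^bsub>G\<^esub> s) > cox_length G S g then g \<otimes>\<^bsub>G\<^esub> s else g)"

definition demazure_product :: "('a, 'b) monoid_scheme \<Rightarrow> 'a set \<Rightarrow> 'a list \<Rightarrow> 'a" where
  "demazure_product G S w = foldl (demazure_step G S) \<one>\<^bsub>G\<^esub> w"

definition absorbable ::
  "('a, 'b) monoid_scheme \<Rightarrow> 'a set \<Rightarrow> 'a list \<Rightarrow> nat set \<Rightarrow> nat \<Rightarrow> bool" where
  "absorbable G S Q D i \<longleftrightarrow>
     reduced_subword G S Q D \<and> i \<in> {..<length Q} - D \<and>
     (let T = D \<union> {i}; \<delta> = (\<lambda>P. demazure_product G S (nths Q P)) in
        \<delta> T = \<delta> D \<and> (THE j. j \<in> D \<and> \<delta> (T - {j}) = \<delta> D) < i)"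

definition abs_set ::
  "('a, 'b) monoid_scheme \<Rightarrow> 'a set \<Rightarrow> 'a list \<Rightarrow> nat set \<Rightarrow> nat set" where
  "abs_set G S Q D = {i. absorbable G S Q D i}"


section \<open>Stanley--Reisner ideals and K-polynomials\<close>

text \<open>
  Polynomials in variables \<open>z\<^sub>i\<close> indexed by all natural numbers; monomials are finitely
  supported exponent vectors.  The polynomials in \<open>z\<^sub>0, \<dots>, z\<^sub>m\<^sub>-\<^sub>1\<close> form the ring
  \<open>poly_ring m\<close>.
\<close>

type_synonym 'k mpoly = "(nat \<Rightarrow>\<^sub>0 nat) \<Rightarrow>\<^sub>0 'k"

definition zvar :: "nat \<Rightarrow> 'k::comm_ring_1 mpoly" where
  "zvar i = Poly_Mapping.single (Poly_Mapping.single i 1) 1"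

definition poly_ring :: "nat \<Rightarrow> 'k::field mpoly ring" where
  "poly_ring m =
     \<lparr>carrier = {p. \<forall>e\<in>Poly_Mapping.keys p. Poly_Mapping.keys e \<subseteq> {..<m}},
      mult = (*), one = 1, zero = 0, add = (+)\<rparr>"

definition stanley_reisner_ideal :: "nat \<Rightarrow> nat set set \<Rightarrow> 'k::field mpoly set" where
  "stanley_reisner_ideal m \<Delta> =
     Idl\<^bsub>poly_ring m\<^esub> {\<Prod>i\<in>D. zvar i | D. D \<subseteq> {..<m} \<and> D \<notin> \<Delta>}"

text \<open>
  A formal power series with integer coefficients is given by its coefficient function
  \<open>(nat \<Rightarrow>\<^sub>0 nat) \<Rightarrow> int\<close>; \<open>series_mult\<close> is the Cauchy product.
\<close>

definition series_mult ::
  "((nat \<Rightarrow>\<^sub>0 nat) \<Rightarrow> int) \<Rightarrow> ((nat \<Rightarrow>\<^sub>0 nat) \<Rightarrow> int) \<Rightarrow> (nat \<Rightarrow>\<^sub>0 nat) \<Rightarrow> int" where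
  "series_mult f g e = (\<Sum>(a, b) \<in> {(a, b). a + b = e}. f a * g b)"

lemma finite_antidiagonal: "finite {(a, b). a + b = (e :: nat \<Rightarrow>\<^sub>0 nat)}"
proof -
  let ?A = "{a. \<exists>b. a + b = e}"
  have le: "Poly_Mapping.lookup a i \<le> Poly_Mapping.lookup e i" if "a \<in> ?A" for a i
    using that by (auto simp: lookup_add)
  let ?F = "{f. \<forall>i. (i \<in> Poly_Mapping.keys e \<longrightarrow> f i \<in> {..Max (Poly_Mapping.lookup e ` Poly_Mapping.keys e)}) \<and>
                    (i \<notin> Poly_Mapping.keys e \<longrightarrow> f i = 0)}"
  have "Poly_Mapping.lookup ` ?A \<subseteq> ?F"
  proof
    fix f assume "f \<in> Poly_Mapping.lookup ` ?A"
    then obtain a where a: "a \<in> ?A" "f = Poly_Mapping.lookup a" by blast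
    have "f i \<le> Max (Poly_Mapping.lookup e ` Poly_Mapping.keys e)" if "i \<in> Poly_Mapping.keys e" for i
      using le[OF a(1), of i] that a(2) by (meson Max_ge finite_imageI finite_keys image_eqI order_trans)
    moreover have "f i = 0" if "i \<notin> Poly_Mapping.keys e" for i
      using le[OF a(1), of i] that a(2) by (simp add: in_keys_iff)
    ultimately show "f \<in> ?F" by auto
  qed
  moreover have "finite ?F"
    by (rule finite_set_of_finite_funs) auto
  ultimately have "finite (Poly_Mapping.lookup ` ?A)" by (rule finite_subset)
  then have "finite ?A"
    by (rule finite_imageD) (auto intro: inj_onI poly_mapping_eqI)
  moreover have "{(a, b). a + b = e} \<subseteq> (\<lambda>a. (a, e - a)) ` ?A"
    by auto
  ultimately show ?thesis
    using finite_surj by blast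
qed

text \<open>The sum of all monomials of \<open>poly_ring m\<close> that lie outside \<open>I\<close>.\<close>

definition hilbert_series :: "nat \<Rightarrow> 'k::field mpoly set \<Rightarrow> (nat \<Rightarrow>\<^sub>0 nat) \<Rightarrow> int" where
  "hilbert_series m I e =
     (if Poly_Mapping.keys e \<subseteq> {..<m} \<and> Poly_Mapping.single e 1 \<notin> I then 1 else 0)"

text \<open>
  \<open>K\<close> is the K-polynomial of \<open>poly_ring m\<close> modulo the monomial ideal \<open>I\<close>:
  the Hilbert series equals \<open>K\<close> divided by the product of all \<open>1 - z\<^sub>i\<close>.
\<close>

definition is_K_polynomial :: "nat \<Rightarrow> 'k::field mpoly set \<Rightarrow> int mpoly \<Rightarrow> bool" where
  "is_K_polynomial m I K \<longleftrightarrow>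
     series_mult (hilbert_series m I) (Poly_Mapping.lookup (\<Prod>i<m. 1 - zvar i)) = Poly_Mapping.lookup K"

lemma is_K_polynomial_unique:
  "is_K_polynomial m I K \<Longrightarrow> is_K_polynomial m I K' \<Longrightarrow> K = K'"
  by (simp add: is_K_polynomial_def poly_mapping_eqI)

end

theory Submission
  imports Defs
begin

text \<open>
  Cut the Hilbert series by the supports of the monomials.  A monomial survives modulo the
  Stanley--Reisner ideal iff its support is a face, and the monomials with support exactly \<open>F\<close>
  add up to \<open>\<Prod>\<^sub>i\<^sub>\<in>\<^sub>F z\<^sub>i / (1 - z\<^sub>i)\<close>.  Hence, for every simplicial complex \<open>\<Delta>\<close> on the vertices
  \<open>U = {..<m}\<close>, the K-polynomial is the sum over all faces \<open>F\<close> of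
  \<open>(\<Prod>\<^sub>i\<^sub>\<in>\<^sub>F z\<^sub>i) (\<Prod>\<^sub>i\<^sub>\<in>\<^sub>U\<^sub>-\<^sub>F (1 - z\<^sub>i))\<close> (\<open>K_polynomial_of_complex\<close>).

  On the other side, multiply the term of a facet \<open>U - D\<close> by \<open>1 = \<Prod>\<^sub>i (z\<^sub>i + (1 - z\<^sub>i))\<close>, where \<open>i\<close>
  runs through the positions outside \<open>D\<close> and \<open>abs(D)\<close>.  After expansion it is the sum of the terms of
  the faces \<open>U - P\<close> with \<open>P\<close> in the interval from \<open>D\<close> to \<open>U - abs(D)\<close>
  (\<open>interval_expansion\<close>).  So the theorem says that these intervals partition the set of all
  \<open>P\<close> that contain \<open>\<pi>\<close>.

  The partition rests on a local description of absorbability: \<open>i\<close> outside \<open>D\<close> is absorbable iff the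
  letter \<open>\<sigma>\<^sub>i\<close> is a right descent of the product of the letters of \<open>D\<close> before position \<open>i\<close>
  (\<open>absorbable_iff_descends\<close>).  If it is a descent, the exchange property yields the letter before
  \<open>i\<close> for which \<open>\<sigma>\<^sub>i\<close> can be exchanged.  If it is not, the Demazure product can be \<open>\<pi>\<close> only because some
  letter after \<open>i\<close> becomes superfluous.  A reduced word and an additional
  letter cannot have two such partners, since then a third deletion would not be reduced.

  With this description \<open>D\<close> can be read off from \<open>P\<close> from right to left: the last letter \<open>\<sigma>\<close> of \<open>P\<close>
  belongs to \<open>D\<close> iff it is a right descent of the element that is still to be spelled.  If it is a
  descent, leaving it out would make it absorbable, and if it is not, no reduced word of the
  element ends in \<open>\<sigma>\<close>.  These are the distinguished subexpressions of Deodhar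
  (\<open>distinguished_unique\<close>).

  Beyond \<open>s\<^sup>2 = 1\<close> for the generators, the only fact about Coxeter groups that enters is the strong
  exchange property.  It is derived from the presentation: the number of times, modulo 2, that a
  reflection occurs among the reflections of a word depends only on the product of the word.
\<close>

section \<open>The strong exchange property\<close>

locale coxeter = group G for G :: "('a, 'b) monoid_scheme" (structure) +
  fixes S :: "'a set"
  assumes coxeter_system: "coxeter_system G S"
begin

abbreviation "wp \<equiv> word_prod G"
abbreviation "len \<equiv> cox_length G S"

lemma gen_closed [simp]: "s \<in> S \<Longrightarrow> s \<in> carrier G"
  using coxeter_system unfolding coxeter_system_def by blast

lemma wp_Nil [simp]: "wp [] = \<one>"
  by (simp add: word_prod_def)

lemma wp_Cons [simp]: "wp (s # w) = s \<otimes> wp w"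
  by (simp add: word_prod_def)

lemma wp_closed [simp]: "set w \<subseteq> S \<Longrightarrow> wp w \<in> carrier G"
  by (induction w) auto

lemma wp_append [simp]: "set u \<subseteq> S \<Longrightarrow> set v \<subseteq> S \<Longrightarrow> wp (u @ v) = wp u \<otimes> wp v"
  by (induction u) (auto simp: m_assoc)

lemma coxeter_presentation:
  obtains M where "coxeter_matrix S M"
    and "\<And>v w. set v \<subseteq> S \<Longrightarrow> set w \<subseteq> S \<Longrightarrow>
           wp v = wp w \<longleftrightarrow> equivclp (relator_step S M) v w"
  using coxeter_system unfolding coxeter_system_def by blast

lemma relator_step_wp:
  assumes "\<And>v w. set v \<subseteq> S \<Longrightarrow> set w \<subseteq> S \<Longrightarrow>
           wp v = wp w \<longleftrightarrow> equivclp (relator_step S M) v w"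
    and "s \<in> S" "t \<in> S"
  shows "wp (concat (replicate (M s t) [s, t])) = \<one>"
proof -
  have "relator_step S M (concat (replicate (M s t) [s, t])) []"
    unfolding relator_step_def using assms(2,3)
    by (intro exI[of _ "[]"] exI[of _ s] exI[of _ t]) auto
  then show ?thesis
    using assms by (subst assms(1)[where w = "[]", simplified]) (auto simp: set_replicate_conv_if)
qed

lemma gen_square [simp]:
  assumes "s \<in> S" shows "s \<otimes> s = \<one>"
proof -
  obtain M where M: "coxeter_matrix S M" "\<And>v w. set v \<subseteq> S \<Longrightarrow> set w \<subseteq> S \<Longrightarrow>
           wp v = wp w \<longleftrightarrow> equivclp (relator_step S M) v w"
    using coxeter_presentation by blast
  have "M s s = 1" using M(1) assms by (simp add: coxeter_matrix_def)
  then show ?thesis using relator_step_wp[OF M(2) assms assms] assms by simp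
qed

lemma gen_inv [simp]: "s \<in> S \<Longrightarrow> inv s = s"
  by (simp add: inv_equality)

lemma gen_cancel_left [simp]: "s \<in> S \<Longrightarrow> x \<in> carrier G \<Longrightarrow> s \<otimes> (s \<otimes> x) = x"
  by (simp flip: m_assoc)

lemma gen_cancel_right [simp]: "s \<in> S \<Longrightarrow> x \<in> carrier G \<Longrightarrow> x \<otimes> s \<otimes> s = x"
  by (simp add: m_assoc)

lemma len_le: "set w \<subseteq> S \<Longrightarrow> len (wp w) \<le> length w"
  unfolding cox_length_def by (rule Least_le) auto

lemma reduced_word_exists:
  assumes "g \<in> carrier G"
  obtains w where "set w \<subseteq> S" "wp w = g" "length w = len g"
proof -
  have "\<exists>w. set w \<subseteq> S \<and> wp w = g"
  proof -
    have "g \<in> generate G S"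
      using assms coxeter_system by (simp add: coxeter_system_def)
    then show ?thesis
    proof (induction rule: generate.induct)
      case one
      show ?case by (intro exI[of _ "[]"]) simp
    next
      case (incl h)
      then show ?case by (intro exI[of _ "[h]"]) simp
    next
      case (inv h)
      then show ?case by (intro exI[of _ "[h]"]) simp
    next
      case (eng h1 h2)
      then obtain u v where "set u \<subseteq> S" "wp u = h1" "set v \<subseteq> S" "wp v = h2" by blast
      then show ?case by (intro exI[of _ "u @ v"]) simp
    qed
  qed
  then have "\<exists>n w. set w \<subseteq> S \<and> wp w = g \<and> length w = n" by blast
  from LeastI_ex[OF this] show ?thesis
    using that unfolding cox_length_def by blast
qed

text \<open>
  For \<open>w = s\<^sub>1 \<dots> s\<^sub>n\<close> this lists the reflections \<open>(s\<^sub>1 \<dots> s\<^sub>k\<^sub>-\<^sub>1) s\<^sub>k (s\<^sub>1 \<dots> s\<^sub>k\<^sub>-\<^sub>1)\<^sup>-\<^sup>1\<close>.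
  Multiplication of the product of \<open>w\<close> by the \<open>k\<close>-th one from the left deletes the letter \<open>s\<^sub>k\<close>.
\<close>

fun reflections :: "'a list \<Rightarrow> 'a list" where
  "reflections [] = []"
| "reflections (s # w) = s # map (\<lambda>t. s \<otimes> t \<otimes> inv s) (reflections w)"

lemma reflections_closed: "set w \<subseteq> S \<Longrightarrow> set (reflections w) \<subseteq> carrier G"
  by (induction w) auto

lemma reflections_append:
  assumes "set u \<subseteq> S" "set v \<subseteq> S"
  shows "reflections (u @ v) = reflections u @ map (\<lambda>t. wp u \<otimes> t \<otimes> inv (wp u)) (reflections v)"
  using assms(1)
proof (induction u)
  case Nil
  have "map (\<lambda>t. \<one> \<otimes> t \<otimes> inv \<one>) (reflections v) = map (\<lambda>t. t) (reflections v)"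
    using reflections_closed[OF assms(2)] by (intro map_cong) auto
  then show ?case by simp
next
  case (Cons s u)
  then show ?case
    using reflections_closed[OF assms(2)] by (auto simp: m_assoc inv_mult_group)
qed

lemma wp_dihedral: "s \<in> S \<Longrightarrow> t \<in> S \<Longrightarrow> wp (concat (replicate n [s, t])) = (s \<otimes> t) [^] n"
proof (induction n)
  case (Suc n)
  then have "wp (concat (replicate (Suc n) [s, t])) = (s \<otimes> t) \<otimes> (s \<otimes> t) [^] n"
    by (simp add: m_assoc)
  then show ?case using Suc.prems by (simp only: nat_pow_Suc2 m_closed gen_closed)
qed simp

lemma reflections_dihedral:
  assumes "s \<in> S" "t \<in> S"
  shows "reflections (concat (replicate n [s, t])) = map (\<lambda>i. (s \<otimes> t) [^] i \<otimes> s) [0..<2 * n]"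
proof (induction n)
  case (Suc n)
  have *: "s \<otimes> (t \<otimes> ((s \<otimes> t) [^] i \<otimes> s) \<otimes> t) \<otimes> s = (s \<otimes> t) [^] Suc (Suc i) \<otimes> s" for i :: nat
  proof -
    have "(s \<otimes> t) [^] Suc (Suc i) = s \<otimes> t \<otimes> ((s \<otimes> t) [^] i \<otimes> (s \<otimes> t))"
      using assms by (metis gen_closed m_assoc m_closed nat_pow_Suc nat_pow_Suc2 nat_pow_closed)
    then show ?thesis using assms by (simp add: m_assoc)
  qed
  have "[0..<2 * Suc n] = 0 # Suc 0 # map (\<lambda>i. Suc (Suc i)) [0..<2 * n]"
    by (simp add: upt_conv_Cons map_Suc_upt flip: map_map[unfolded comp_def, of Suc Suc])
  then show ?case using assms * Suc by simp
qed simp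

text \<open>
  The \<open>i\<close>-th reflection \<open>(s t)\<^sup>i s\<close> of an alternating word of length \<open>2 n\<close> is periodic in \<open>i\<close> with
  period \<open>n\<close> as soon as \<open>(s t)\<^sup>n = 1\<close>.
\<close>

lemma reflections_relator:
  assumes "s \<in> S" "t \<in> S" "(s \<otimes> t) [^] n = \<one>"
  obtains ts where "reflections (concat (replicate n [s, t])) = ts @ ts"
proof -
  have "(s \<otimes> t) [^] (i + n) = (s \<otimes> t) [^] i" for i
    using assms by (simp flip: nat_pow_mult)
  then have "map (\<lambda>i. (s \<otimes> t) [^] i \<otimes> s) (map (\<lambda>i. i + n) [0..<n])
      = map (\<lambda>i. (s \<otimes> t) [^] i \<otimes> s) [0..<n]" by simp
  moreover have "[0..<2 * n] = [0..<n] @ map (\<lambda>i. i + n) [0..<n]"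
    by (simp add: map_add_upt mult_2 upt_add_eq_append[of 0])
  ultimately show ?thesis
    using that reflections_dihedral[OF assms(1,2)] by (metis map_append)
qed

text \<open>
  A relator has product 1, so its removal does not change the conjugating prefixes of
  the letters after it, and by \<open>reflections_relator\<close> it takes away each reflection an even number of
  times.
\<close>

lemma reflections_parity:
  assumes "set v \<subseteq> S" "set w \<subseteq> S" "wp v = wp w"
  shows "even (count_list (reflections v) t) \<longleftrightarrow> even (count_list (reflections w) t)"
proof -
  obtain M where M: "\<And>v w. set v \<subseteq> S \<Longrightarrow> set w \<subseteq> S \<Longrightarrow>
           wp v = wp w \<longleftrightarrow> equivclp (relator_step S M) v w"
    using coxeter_presentation by blast
  have step: "even (count_list (reflections v) t) \<longleftrightarrow> even (count_list (reflections w) t)"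
    if "relator_step S M v w" for v w
  proof -
    from that obtain x y a b where
      xy: "set x \<subseteq> S" "set y \<subseteq> S" "a \<in> S" "b \<in> S" "w = x @ y"
      and v: "v = x @ concat (replicate (M a b) [a, b]) @ y"
      unfolding relator_step_def by blast
    let ?r = "concat (replicate (M a b) [a, b])"
    have r: "set ?r \<subseteq> S" using xy by auto
    have one: "wp ?r = \<one>" using relator_step_wp[OF M] xy by blast
    obtain ts where ts: "reflections ?r = ts @ ts"
      using reflections_relator one wp_dihedral xy by metis
    have "reflections v = reflections x @ map (\<lambda>t. wp x \<otimes> t \<otimes> inv wp x) (ts @ ts)
        @ map (\<lambda>t. wp x \<otimes> t \<otimes> inv wp x) (reflections y)"
    proof -
      have "map (\<lambda>t. \<one> \<otimes> t \<otimes> inv \<one>) (reflections y) = map (\<lambda>t. t) (reflections y)"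
        using reflections_closed[OF xy(2)] by (intro map_cong) auto
      then have "reflections (?r @ y) = ts @ ts @ reflections y"
        using xy r one ts by (simp only: reflections_append) simp
      moreover have "set (?r @ y) \<subseteq> S" using r xy by simp
      ultimately show ?thesis unfolding v
        using xy reflections_append[of x "?r @ y"] by simp
    qed
    moreover have "reflections w = reflections x @ map (\<lambda>t. wp x \<otimes> t \<otimes> inv wp x) (reflections y)"
      using xy by (simp add: reflections_append)
    ultimately show ?thesis by auto
  qed
  have "equivclp (relator_step S M) v w" using M assms by blast
  then show ?thesis
    by (induction rule: equivclp_induct) (use step in auto)
qed

lemma reflection_deletes:
  assumes "set w \<subseteq> S" "t \<in> set (reflections w)"
  shows "\<exists>u a v. w = u @ a # v \<and> t \<otimes> wp w = wp (u @ v)"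
  using assms
proof (induction w arbitrary: t)
  case (Cons s w)
  show ?case
  proof (cases "t = s")
    case True
    then show ?thesis using Cons.prems
      by (intro exI[of _ "[]"] exI[of _ s] exI[of _ w]) simp
  next
    case False
    then obtain t' where t': "t' \<in> set (reflections w)" "t = s \<otimes> t' \<otimes> inv s"
      using Cons.prems by auto
    then obtain u a v where w: "w = u @ a # v" and eq: "t' \<otimes> wp w = wp (u @ v)"
      using Cons by (metis insert_subset list.simps(15))
    have "t' \<in> carrier G" using t' Cons.prems reflections_closed by auto
    then have "t \<otimes> wp (s # w) = s \<otimes> (t' \<otimes> wp w)"
      using t' Cons.prems by (simp add: m_assoc)
    then show ?thesis using w eq
      by (intro exI[of _ "s # u"] exI[of _ a] exI[of _ v]) simp
  qed
qed simp

text \<open>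
  Let \<open>t\<close> be the reflection with \<open>t g = g s\<close> for the product \<open>g\<close> of \<open>w\<close>.  Take a reduced word \<open>w'\<close> of
  \<open>g s\<close>.  Then \<open>w' s\<close> is a word for \<open>g\<close> whose last reflection is \<open>t\<close>, and \<open>t\<close> does not occur among
  the reflections of \<open>w'\<close>, because otherwise \<open>t (g s) = g\<close> would be shorter than \<open>g s\<close>.  By
  parity \<open>t\<close> also occurs among the reflections of \<open>w\<close>.
\<close>

lemma strong_exchange:
  assumes w: "set w \<subseteq> S" and s: "s \<in> S"
    and le: "len (wp w \<otimes> s) \<le> len (wp w)"
  obtains u a v where "w = u @ a # v" "wp (u @ v) = wp w \<otimes> s"
proof -
  let ?h = "wp w \<otimes> s"
  obtain w' where w': "set w' \<subseteq> S" "wp w' = ?h" "length w' = len ?h"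
    using reduced_word_exists[of ?h] w s by auto
  define t where "t = ?h \<otimes> s \<otimes> inv ?h"
  have th: "t \<otimes> ?h = wp w" and tw: "t \<otimes> wp w = ?h"
    using w s by (auto simp: t_def m_assoc inv_mult_group simp flip: m_assoc[of "inv wp w"])
  have "t \<notin> set (reflections w')"
  proof
    assume "t \<in> set (reflections w')"
    then obtain u a v where "w' = u @ a # v" "t \<otimes> wp w' = wp (u @ v)"
      using reflection_deletes w' by blast
    then show False
      using len_le[of "u @ v"] w' th le by simp
  qed
  moreover have "reflections (w' @ [s]) = reflections w' @ [t]"
    using w' s by (simp add: reflections_append t_def)
  ultimately have "odd (count_list (reflections (w' @ [s])) t)" by simp
  moreover have "wp (w' @ [s]) = wp w" using w' w s by simp
  ultimately have "odd (count_list (reflections w) t)"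
    using reflections_parity[of "w' @ [s]" w] w' w s by simp
  then have "t \<in> set (reflections w)"
    by (metis count_notin even_zero)
  from reflection_deletes[OF w this] show ?thesis using that tw by metis
qed

end

section \<open>Splitting subwords at a position\<close>

lemma nths_Un_less:
  assumes "\<And>x y. x \<in> A \<Longrightarrow> y \<in> B \<Longrightarrow> x < y"
  shows "nths w (A \<union> B) = nths w A @ nths w B"
  using assms
proof (induction w arbitrary: A B)
  case (Cons s w)
  have "nths w ({j. Suc j \<in> A} \<union> {j. Suc j \<in> B}) = nths w {j. Suc j \<in> A} @ nths w {j. Suc j \<in> B}"
    using Cons.prems by (intro Cons.IH) auto
  moreover have "A = {}" if "0 \<in> B"
    using Cons.prems that by fastforce
  ultimately show ?case by (auto simp: nths_Cons Collect_disj_eq)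
qed simp

lemma nths_single: "i < length w \<Longrightarrow> nths w {i} = [w ! i]"
  by (induction w arbitrary: i) (auto simp: nths_Cons nth_Cons split: nat.split)

lemma nths_split_at:
  assumes "i \<in> X" "i < length w"
  shows "nths w X = nths w (X \<inter> {..<i}) @ w ! i # nths w (X \<inter> {i<..})"
proof -
  have "X = (X \<inter> {..<i}) \<union> ({i} \<union> (X \<inter> {i<..}))" using assms by auto
  then have "nths w X = nths w ((X \<inter> {..<i}) \<union> ({i} \<union> (X \<inter> {i<..})))" by simp
  also have "\<dots> = nths w (X \<inter> {..<i}) @ nths w {i} @ nths w (X \<inter> {i<..})"
    by (subst nths_Un_less, force, subst nths_Un_less) auto
  finally show ?thesis using assms by (simp add: nths_single)
qed

lemma nths_remove_at:
  "nths w (X - {i}) = nths w (X \<inter> {..<i}) @ nths w (X \<inter> {i<..})"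
proof -
  have "X - {i} = (X \<inter> {..<i}) \<union> (X \<inter> {i<..})" by auto
  then show ?thesis by (simp only:) (rule nths_Un_less, auto)
qed

lemma length_nths_eq_card: "X \<subseteq> {..<length w} \<Longrightarrow> length (nths w X) = card X"
  by (auto simp: length_nths intro: arg_cong[of _ _ card])

lemma nths_split_listD:
  assumes "X \<subseteq> {..<length w}" "nths w X = u @ a # v"
  obtains j where "j \<in> X" "nths w (X - {j}) = u @ v"
proof -
  have "\<exists>j. j \<in> X \<and> nths w (X \<inter> {..<j}) = u \<and> nths w (X \<inter> {j<..}) = v"
    using assms
  proof (induction w arbitrary: X u)
    case (Cons s w)
    let ?X = "{j. Suc j \<in> X}"
    have lt: "\<And>j. {i. Suc i \<in> X \<and> Suc i < Suc j} = ?X \<inter> {..<j}"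
      and gt: "\<And>j. {i. Suc i \<in> X \<and> Suc j < Suc i} = ?X \<inter> {j<..}" by auto
    have sub: "?X \<subseteq> {..<length w}" using Cons.prems by auto
    show ?case
    proof (cases "0 \<in> X \<and> u = []")
      case True
      then have "nths (s # w) (X \<inter> {0<..}) = nths w ?X" by (simp add: nths_Cons)
      then show ?thesis using True Cons.prems by (intro exI[of _ 0]) (auto simp: nths_Cons)
    next
      case False
      obtain u' where u': "nths w ?X = u' @ a # v" "u = (if 0 \<in> X then [s] else []) @ u'"
        using Cons.prems(2) False by (cases u) (auto simp: nths_Cons split: if_splits)
      from Cons.IH[OF sub u'(1)] obtain j where
        "j \<in> ?X" "nths w (?X \<inter> {..<j}) = u'" "nths w (?X \<inter> {j<..}) = v" by blast
      then show ?thesis using u'(2)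
        by (intro exI[of _ "Suc j"]) (auto simp: nths_Cons lt gt Int_def)
    qed
  qed simp
  then show ?thesis using that by (auto simp: nths_remove_at)
qed

section \<open>Demazure products of reduced words\<close>

context coxeter
begin

abbreviation "reduced_word w \<equiv> len (wp w) = length w"

lemma reduced_append_left:
  assumes "set u \<subseteq> S" "set v \<subseteq> S" "reduced_word (u @ v)"
  shows "reduced_word u"
proof -
  obtain u' where u': "set u' \<subseteq> S" "wp u' = wp u" "length u' = len (wp u)"
    using reduced_word_exists[of "wp u"] assms by auto
  then have "len (wp (u @ v)) \<le> length (u' @ v)"
    using len_le[of "u' @ v"] assms by simp
  then have "length u \<le> len (wp u)" using assms u' by simp
  then show ?thesis using len_le[OF assms(1)] by simp
qed

lemma len_mult_le:
  assumes "g \<in> carrier G" "set v \<subseteq> S"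
  shows "len (g \<otimes> wp v) \<le> len g + length v"
proof -
  obtain u where u: "set u \<subseteq> S" "wp u = g" "length u = len g"
    using reduced_word_exists[OF assms(1)] by auto
  then show ?thesis using len_le[of "u @ v"] assms by simp
qed

text \<open>
  Each step of the Demazure product raises the length by at most one, and it multiplies
  whenever it raises the length.  So a Demazure product of maximal length is an ordinary product.
\<close>

lemma demazure_fold:
  assumes "g \<in> carrier G" "set v \<subseteq> S"
  shows "foldl (demazure_step G S) g v \<in> carrier G
    \<and> len (foldl (demazure_step G S) g v) \<le> len g + length v
    \<and> (len (foldl (demazure_step G S) g v) = len g + length v
        \<longrightarrow> foldl (demazure_step G S) g v = g \<otimes> wp v)"
  using assms
proof (induction v arbitrary: g)
  case (Cons s v)
  let ?h = "demazure_step G S g s"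
  have s: "s \<in> S" "set v \<subseteq> S" using Cons.prems by auto
  have h: "?h \<in> carrier G" using Cons.prems by (simp add: demazure_step_def)
  have le: "len ?h \<le> Suc (len g)"
    using len_mult_le[of g "[s]"] Cons.prems by (simp add: demazure_step_def)
  have eq: "?h = g \<otimes> s" if "len ?h = Suc (len g)"
    using that by (auto simp: demazure_step_def split: if_splits)
  have "g \<otimes> s \<otimes> wp v = g \<otimes> wp (s # v)" using Cons.prems s by (simp add: m_assoc)
  then show ?case using Cons.IH[OF h s(2)] le eq by force
qed simp

lemma len_one [simp]: "len \<one> = 0"
  using len_le[of "[]"] by simp

lemma demazure_full_length:
  assumes "set v \<subseteq> S" "len (demazure_product G S v) = length v"
  shows "demazure_product G S v = wp v"
  using demazure_fold[of \<one> v] assms by (simp add: demazure_product_def)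

lemma demazure_fold_reduced:
  assumes "set u \<subseteq> S" "set v \<subseteq> S" "reduced_word (u @ v)"
  shows "foldl (demazure_step G S) (wp u) v = wp (u @ v)"
  using assms
proof (induction v arbitrary: u)
  case (Cons s v)
  have "reduced_word (u @ [s])" "reduced_word u"
    using reduced_append_left[of "u @ [s]" v] reduced_append_left[of u "s # v"] Cons.prems by auto
  then have "demazure_step G S (wp u) s = wp (u @ [s])"
    using Cons.prems by (simp add: demazure_step_def)
  then show ?case using Cons.IH[of "u @ [s]"] Cons.prems by simp
qed simp

lemma demazure_reduced:
  "set v \<subseteq> S \<Longrightarrow> reduced_word v \<Longrightarrow> demazure_product G S v = wp v"
  using demazure_fold_reduced[of "[]" v] by (simp add: demazure_product_def)

lemma demazure_append:
  assumes "set u \<subseteq> S" "set v \<subseteq> S" "reduced_word u"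
  shows "demazure_product G S (u @ v) = foldl (demazure_step G S) (wp u) v"
  using demazure_reduced[OF assms(1,3)] by (simp add: demazure_product_def)

end

section \<open>Absorbable letters\<close>

locale subwords = coxeter +
  fixes Q :: "'a list"
  assumes Q: "set Q \<subseteq> S"
begin

abbreviation "W X \<equiv> wp (nths Q X)"

lemma nths_closed [simp]: "set (nths Q X) \<subseteq> S"
  using Q set_nths_subset by fastforce

lemma nth_closed [simp]: "i < length Q \<Longrightarrow> Q ! i \<in> S"
  using Q by auto

lemma represents_iff:
  "represents G S Q D g \<longleftrightarrow> D \<subseteq> {..<length Q} \<and> W D = g \<and> len g = card D"
  unfolding represents_def using length_nths_eq_card by metis

lemma len_W_le: "X \<subseteq> {..<length Q} \<Longrightarrow> len (W X) \<le> card X"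
  using len_le[of "nths Q X"] by (simp add: length_nths_eq_card)

lemma W_split:
  assumes "i \<in> X" "i < length Q"
  shows "W X = W (X \<inter> {..<i}) \<otimes> (Q ! i \<otimes> W (X \<inter> {i<..}))"
  using assms by (simp add: nths_split_at[OF assms])

lemma W_remove: "W (X - {i}) = W (X \<inter> {..<i}) \<otimes> W (X \<inter> {i<..})"
  by (simp add: nths_remove_at)

text \<open>
  Both inequalities mean a right descent, since equality of the two lengths never occurs
  (\<open>descent_iff\<close>).  The weak one is the hypothesis of \<open>strong_exchange\<close> and the negation of
  the growth condition in the Demazure product.
\<close>

definition descends_at :: "nat set \<Rightarrow> nat \<Rightarrow> bool" where
  "descends_at D i \<longleftrightarrow> len (W (D \<inter> {..<i}) \<otimes> Q ! i) \<le> len (W (D \<inter> {..<i}))"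

text \<open>
  Write the word of \<open>X\<close> as \<open>u a v b y c z\<close> with \<open>a\<close>, \<open>b\<close>, \<open>c\<close> at \<open>p\<close>, \<open>q\<close>, \<open>r\<close>.  If the deletions
  of \<open>a\<close> and of \<open>b\<close> have the same product, then \<open>v b = a v\<close>, that is, \<open>a v b = v\<close>.  Hence after the
  deletion of \<open>c\<close> the letters \<open>a\<close> and \<open>b\<close> cancel as well.
\<close>

lemma two_equal_deletions:
  assumes X: "X \<subseteq> {..<length Q}" "p \<in> X" "q \<in> X" "r \<in> X" "p < q" "q < r"
    and eq: "W (X - {p}) = W (X - {q})"
  shows "len (W (X - {r})) + 3 \<le> card X"
proof -
  have lt: "p < length Q" "q < length Q" "r < length Q" using X by auto
  let ?U = "X \<inter> {..<p}" and ?V = "X \<inter> {p<..<q}" and ?Y = "X \<inter> {q<..} - {r}"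
  let ?Y' = "X \<inter> {q<..}"
  have 1: "X - {p} = ?U \<union> (?V \<union> ({q} \<union> ?Y'))"
    and 2: "X - {q} = ?U \<union> ({p} \<union> (?V \<union> ?Y'))"
    and 3: "X - {r} = ?U \<union> ({p} \<union> (?V \<union> ({q} \<union> ?Y)))"
    and 4: "X - {p, q, r} = ?U \<union> (?V \<union> ?Y)"
    using X by auto
  have w1: "W (X - {p}) = W ?U \<otimes> (W ?V \<otimes> (Q ! q \<otimes> W ?Y'))"
    unfolding 1 using X lt
    by (subst nths_Un_less, force, subst nths_Un_less, force, subst nths_Un_less)
      (auto simp: nths_single)
  have w2: "W (X - {q}) = W ?U \<otimes> (Q ! p \<otimes> (W ?V \<otimes> W ?Y'))"
    unfolding 2 using X lt
    by (subst nths_Un_less, force, subst nths_Un_less, force, subst nths_Un_less)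
      (auto simp: nths_single)
  have w3: "W (X - {r}) = W ?U \<otimes> (Q ! p \<otimes> (W ?V \<otimes> (Q ! q \<otimes> W ?Y)))"
    unfolding 3 using X lt
    by (subst nths_Un_less, force, subst nths_Un_less, force, subst nths_Un_less, force,
        subst nths_Un_less) (auto simp: nths_single)
  have w4: "W (X - {p, q, r}) = W ?U \<otimes> (W ?V \<otimes> W ?Y)"
    unfolding 4 using X lt
    by (subst nths_Un_less, force, subst nths_Un_less) (auto simp: nths_single)
  have "W ?V \<otimes> (Q ! q \<otimes> W ?Y') = Q ! p \<otimes> (W ?V \<otimes> W ?Y')"
    using eq lt unfolding w1 w2 by simp
  then have "W ?V \<otimes> Q ! q = Q ! p \<otimes> W ?V"
    using lt by (simp flip: m_assoc)
  then have "Q ! p \<otimes> W ?V \<otimes> Q ! q = W ?V"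
    using lt by (metis gen_cancel_right nth_closed nths_closed wp_closed)
  then have "W (X - {r}) = W (X - {p, q, r})"
    unfolding w3 w4 using lt by (metis gen_closed m_assoc m_closed nth_closed nths_closed wp_closed)
  moreover have "len (W (X - {p, q, r})) \<le> card (X - {p, q, r})"
    using X by (intro len_W_le) auto
  moreover have "card (X - {p, q, r}) + 3 = card X"
  proof -
    have "finite X" "card {p, q, r} = 3" using X finite_subset by auto
    then show ?thesis using X card_mono[of X "{p, q, r}"] by (subst card_Diff_subset) auto
  qed
  ultimately show ?thesis by simp
qed

text \<open>
  Among three positions whose deletion leaves a reduced word of \<open>g\<close>, the first two contradict
  the third by \<open>two_equal_deletions\<close>.
\<close>

lemma deletion_unique:
  assumes X: "X \<subseteq> {..<length Q}" and g: "card X = Suc (len g)"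
    and in_X: "i \<in> X" "j \<in> X" "k \<in> X" and ne: "i \<noteq> j" "i \<noteq> k"
    and eq: "W (X - {i}) = g" "W (X - {j}) = g" "W (X - {k}) = g"
  shows "j = k"
proof (rule ccontr)
  assume "j \<noteq> k"
  have False if "p < q" "q < r" "{p, q, r} = {i, j, k}" for p q r
  proof -
    have "p \<in> {i, j, k}" "q \<in> {i, j, k}" "r \<in> {i, j, k}" using that by blast+
    then have "p \<in> X" "q \<in> X" "r \<in> X" "W (X - {p}) = g" "W (X - {q}) = g" "W (X - {r}) = g"
      using in_X eq by auto
    then show False using two_equal_deletions[OF X, of p q r] that g by simp
  qed
  then show False using ne \<open>j \<noteq> k\<close>
    by (metis insert_commute linorder_neqE_nat)
qed

lemma demazure_eq_iff_W:
  assumes "X \<subseteq> {..<length Q}" "card X = len g"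
  shows "demazure_product G S (nths Q X) = g \<longleftrightarrow> W X = g"
  using assms demazure_full_length[of "nths Q X"] demazure_reduced[of "nths Q X"]
  by (auto simp: length_nths_eq_card)

text \<open>
  The exchange takes place inside the prefix of \<open>D\<close> before \<open>i\<close>: deleting the right letter there
  multiplies the prefix by \<open>\<sigma>\<^sub>i\<close>, and the added letter \<open>\<sigma>\<^sub>i\<close> undoes this.
\<close>

lemma exchange_before:
  assumes D: "represents G S Q D g" and i: "i < length Q" "i \<notin> D" "descends_at D i"
  obtains j where "j \<in> D" "j < i" "W (insert i D - {j}) = g"
proof -
  have DQ: "D \<subseteq> {..<length Q}" "W D = g" using D by (auto simp: represents_iff)
  obtain u a v where *: "nths Q (D \<inter> {..<i}) = u @ a # v" "wp (u @ v) = W (D \<inter> {..<i}) \<otimes> Q ! i"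
    using strong_exchange[of "nths Q (D \<inter> {..<i})" "Q ! i"] i by (auto simp: descends_at_def)
  obtain j where j: "j \<in> D \<inter> {..<i}" "nths Q (D \<inter> {..<i} - {j}) = u @ v"
    using nths_split_listD[of "D \<inter> {..<i}" Q u a v] *(1) DQ by auto
  have "insert i D - {j} = (D \<inter> {..<i} - {j}) \<union> ({i} \<union> (D \<inter> {i<..}))"
    using j i by auto
  then have "nths Q (insert i D - {j}) = u @ v @ [Q ! i] @ nths Q (D \<inter> {i<..})"
    using j(2) i(1) by (simp only:) (subst nths_Un_less, force, subst nths_Un_less, auto simp: nths_single)
  moreover have "set (u @ v) \<subseteq> S" using nths_closed[of "D \<inter> {..<i} - {j}"] j(2) by simp
  ultimately have "W (insert i D - {j}) = wp (u @ v) \<otimes> (Q ! i \<otimes> W (D \<inter> {i<..}))"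
    using i by (simp add: m_assoc)
  also have "\<dots> = W (D \<inter> {..<i}) \<otimes> W (D \<inter> {i<..})"
    using i *(2) by (simp add: m_assoc)
  also have "\<dots> = W (D - {i})" by (simp add: W_remove)
  finally show ?thesis using that j i DQ by auto
qed

text \<open>
  Read \<open>D \<union> {i}\<close> from left to right up to the first letter \<open>\<sigma>\<^sub>j\<close> after which the word read is no longer
  reduced.  It lies after \<open>i\<close>, and the Demazure product ignores it.  The lengths then leave
  no room for a second ignored letter, so that the ordinary product of the remaining word is \<open>g\<close>.
\<close>

lemma exchange_after:
  assumes D: "represents G S Q D g" and i: "i < length Q" "i \<notin> D" "\<not> descends_at D i"
    and dem: "demazure_product G S (nths Q (insert i D)) = g"
  obtains j where "j \<in> D" "i < j" "W (insert i D - {j}) = g"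
proof -
  let ?T = "insert i D"
  have DQ: "D \<subseteq> {..<length Q}" "W D = g" "len g = card D" using D by (auto simp: represents_iff)
  have TQ: "?T \<subseteq> {..<length Q}" using DQ i by auto
  have fin: "finite D" using DQ finite_subset by auto
  let ?red = "\<lambda>k. reduced_word (nths Q (?T \<inter> {..<k}))"
  have "\<not> ?red (length Q)"
  proof
    assume "?red (length Q)"
    moreover have "?T \<inter> {..<length Q} = ?T" using TQ by auto
    ultimately have "len g = card ?T"
      using dem demazure_reduced[of "nths Q ?T"] length_nths_eq_card[OF TQ] by simp
    then show False using DQ(3) fin i by simp
  qed
  \<comment> \<open>\<open>\<sigma>\<^sub>j\<close> with \<open>k = j + 1\<close> is the first letter that destroys reducedness\<close>
  define k where "k = (LEAST k. \<not> ?red k)"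
  have k: "\<not> ?red k" unfolding k_def by (rule LeastI) fact
  have below: "?red l" if "l < k" for l using not_less_Least[of l] that k_def by blast
  have "?red (Suc i)"
  proof -
    have "nths Q D = nths Q (D \<inter> {..<i}) @ nths Q (D \<inter> {i<..})"
      using nths_remove_at[of Q D i] i by simp
    then have "reduced_word (nths Q (D \<inter> {..<i}))"
      using reduced_append_left[of "nths Q (D \<inter> {..<i})" "nths Q (D \<inter> {i<..})"] DQ
        length_nths_eq_card[of D Q] by simp
    moreover have "len (W (D \<inter> {..<i}) \<otimes> Q ! i) \<le> Suc (len (W (D \<inter> {..<i})))"
      using len_mult_le[of "W (D \<inter> {..<i})" "[Q ! i]"] i by simp
    moreover have "nths Q (?T \<inter> {..<Suc i}) = nths Q (D \<inter> {..<i}) @ [Q ! i]"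
    proof -
      have "?T \<inter> {..<Suc i} \<inter> {..<i} = D \<inter> {..<i}" "?T \<inter> {..<Suc i} \<inter> {i<..} = {}" by auto
      then show ?thesis using nths_split_at[of i "?T \<inter> {..<Suc i}" Q] i by simp
    qed
    ultimately show ?thesis using i by (simp add: descends_at_def)
  qed
  moreover have mono: "?red l" if "?red l'" "l \<le> l'" for l l'
  proof -
    have "?T \<inter> {..<l'} = (?T \<inter> {..<l}) \<union> (?T \<inter> {l..<l'})" using that by auto
    then have "nths Q (?T \<inter> {..<l'}) = nths Q (?T \<inter> {..<l}) @ nths Q (?T \<inter> {l..<l'})"
      by (simp only:) (rule nths_Un_less, auto)
    then show ?thesis using that reduced_append_left[of "nths Q (?T \<inter> {..<l})" "nths Q (?T \<inter> {l..<l'})"] by simp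
  qed
  ultimately have "Suc i < k" using k by (meson not_less)
  then obtain j where j: "k = Suc j" "i < j" by (cases k) auto
  have "?red j" by (rule below) (simp add: j)
  have jT: "j \<in> ?T"
  proof (rule ccontr)
    assume "j \<notin> ?T"
    then have "?T \<inter> {..<Suc j} = ?T \<inter> {..<j}" by (auto simp: less_Suc_eq)
    then show False using k \<open>?red j\<close> j by simp
  qed
  then have jD: "j \<in> D" "j < length Q" using j DQ by auto
  let ?u = "nths Q (?T \<inter> {..<j})" and ?v = "nths Q (?T \<inter> {j<..})"
  have T: "nths Q ?T = ?u @ Q ! j # ?v" using nths_split_at[OF jT jD(2)] .
  have "nths Q (?T \<inter> {..<Suc j}) = ?u @ [Q ! j]"
  proof -
    have "?T \<inter> {..<Suc j} \<inter> {..<j} = ?T \<inter> {..<j}" "?T \<inter> {..<Suc j} \<inter> {j<..} = {}" by auto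
    then show ?thesis using nths_split_at[of j "?T \<inter> {..<Suc j}" Q] jT jD by simp
  qed
  then have "len (wp ?u \<otimes> Q ! j) \<noteq> Suc (len (wp ?u))"
    using k j \<open>?red j\<close> jD by simp
  moreover have "len (wp ?u \<otimes> Q ! j) \<le> Suc (len (wp ?u))"
    using len_mult_le[of "wp ?u" "[Q ! j]"] jD by simp
  ultimately have stay: "demazure_step G S (wp ?u) (Q ! j) = wp ?u"
    by (simp add: demazure_step_def)
  have "g = foldl (demazure_step G S) (wp ?u) ?v"
    using dem stay \<open>?red j\<close> jD by (simp add: T demazure_append)
  moreover have "len g = len (wp ?u) + length ?v"
    using \<open>?red j\<close> length_nths_eq_card[OF TQ] DQ(3) fin i(2) unfolding T by simp
  ultimately have "g = wp ?u \<otimes> wp ?v"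
    using demazure_fold[of "wp ?u" ?v] by simp
  then show ?thesis using that[of j] jD j by (simp add: W_remove)
qed

text \<open>
  The position \<open>i\<close> itself is one whose deletion from \<open>D \<union> {i}\<close> gives \<open>g\<close>.  So
  \<open>deletion_unique\<close> leaves room for exactly one partner in \<open>D\<close>, and whether it stands before
  or after \<open>i\<close> is decided by \<open>exchange_before\<close> and \<open>exchange_after\<close>.
\<close>

lemma absorbable_iff_descends:
  assumes D: "represents G S Q D g"
  shows "absorbable G S Q D i \<longleftrightarrow> i < length Q \<and> i \<notin> D \<and> descends_at D i"
proof (cases "i < length Q \<and> i \<notin> D")
  case False
  then show ?thesis by (auto simp: absorbable_def)
next
  case True
  let ?T = "insert i D" and ?d = "\<lambda>X. demazure_product G S (nths Q X)"
  have DQ: "D \<subseteq> {..<length Q}" "W D = g" "len g = card D" using D by (auto simp: represents_iff)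
  have fin: "finite D" using DQ finite_subset by auto
  have TQ: "?T \<subseteq> {..<length Q}" and cT: "card ?T = Suc (len g)" using DQ True fin by auto
  have dD: "?d D = g" using demazure_eq_iff_W DQ by simp
  have red: "reduced_subword G S Q D"
    unfolding reduced_subword_def using D DQ by (intro bexI[of _ g]) auto
  have del: "?d (?T - {j}) = g \<longleftrightarrow> W (?T - {j}) = g" if "j \<in> D" for j
    using TQ cT fin that by (intro demazure_eq_iff_W) auto
  have Ti: "?T - {i} = D" using True by auto
  have the: "(THE j. j \<in> D \<and> ?d (?T - {j}) = g) = j" if "j \<in> D" "W (?T - {j}) = g" for j
  proof (rule the_equality)
    show "j \<in> D \<and> ?d (?T - {j}) = g" using that del by simp
    fix k assume "k \<in> D \<and> ?d (?T - {k}) = g"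
    then show "k = j"
      using deletion_unique[OF TQ cT, of i k j] True that del DQ Ti by auto
  qed
  have abs: "absorbable G S Q D i \<longleftrightarrow> ?d ?T = g \<and> (THE j. j \<in> D \<and> ?d (?T - {j}) = g) < i"
    using red True dD unfolding absorbable_def Let_def by simp
  show ?thesis
  proof (cases "descends_at D i")
    case desc: True
    then obtain j where j: "j \<in> D" "j < i" "W (?T - {j}) = g"
      using exchange_before[OF D] True by blast
    have "?d ?T = g"
    proof -
      have i: "nths Q ?T = nths Q (D \<inter> {..<i}) @ Q ! i # nths Q (D \<inter> {i<..})"
        using nths_split_at[of i ?T Q] True by (simp add: Int_insert_left)
      have D': "nths Q D = nths Q (D \<inter> {..<i}) @ nths Q (D \<inter> {i<..})"
        using nths_remove_at[of Q D i] True by simp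
      have rD: "reduced_word (nths Q D)" using DQ length_nths_eq_card[of D Q] by simp
      then have "reduced_word (nths Q (D \<inter> {..<i}))"
        using reduced_append_left[of "nths Q (D \<inter> {..<i})" "nths Q (D \<inter> {i<..})"] D' by simp
      moreover have "demazure_step G S (W (D \<inter> {..<i})) (Q ! i) = W (D \<inter> {..<i})"
        using desc by (simp add: demazure_step_def descends_at_def)
      ultimately have "?d ?T = foldl (demazure_step G S) (W (D \<inter> {..<i})) (nths Q (D \<inter> {i<..}))"
        using True by (simp add: i demazure_append)
      also have "\<dots> = W D" using demazure_fold_reduced rD D' by simp
      finally show ?thesis using DQ by simp
    qed
    then show ?thesis using abs the[OF j(1,3)] j True desc by simp
  next
    case False
    have "\<not> absorbable G S Q D i"
    proof
      assume "absorbable G S Q D i"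
      then have *: "?d ?T = g" "(THE j. j \<in> D \<and> ?d (?T - {j}) = g) < i" using abs by auto
      obtain j where "j \<in> D" "i < j" "W (?T - {j}) = g"
        using exchange_after[OF D _ _ False *(1)] True by blast
      then show False using the *(2) by simp
    qed
    then show ?thesis using False by simp
  qed
qed

section \<open>Distinguished subwords\<close>

text \<open>
  By \<open>absorbable_iff_descends\<close> the last condition says that \<open>P\<close> avoids the absorbable letters of \<open>D\<close>.
  In this form it is local: whether it holds at \<open>i\<close> depends only on the part of \<open>D\<close> before \<open>i\<close>, which is
  what makes an induction from the right end possible.
\<close>

definition distinguished :: "nat set \<Rightarrow> nat set \<Rightarrow> 'a \<Rightarrow> bool" where
  "distinguished P D g \<longleftrightarrow> D \<subseteq> P \<and> represents G S Q D g \<and> (\<forall>i\<in>P - D. \<not> descends_at D i)"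

lemma represents_insert_last:
  assumes "D \<subseteq> {..<k}" "k < length Q" "g \<in> carrier G" "len (g \<otimes> Q ! k) < len g"
  shows "represents G S Q (insert k D) g \<longleftrightarrow> represents G S Q D (g \<otimes> Q ! k)"
proof -
  have "nths Q (insert k D) = nths Q D @ [Q ! k]"
    using nths_Un_less[of D "{k}" Q] assms by (auto simp: nths_single)
  then have W: "W (insert k D) = W D \<otimes> Q ! k" using assms by simp
  have fin: "finite D" "k \<notin> D" using assms finite_subset by auto
  have len: "len g \<le> Suc (len (g \<otimes> Q ! k))"
    using len_mult_le[of "g \<otimes> Q ! k" "[Q ! k]"] assms by simp
  have "W D \<otimes> Q ! k = g \<longleftrightarrow> W D = g \<otimes> Q ! k"
    using assms by (metis gen_cancel_right nth_closed nths_closed wp_closed)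
  then show ?thesis using W fin len assms by (auto simp: represents_iff)
qed

lemma descent_iff:
  assumes "g \<in> carrier G" "s \<in> S"
  shows "len (g \<otimes> s) \<le> len g \<longleftrightarrow> len (g \<otimes> s) < len g"
proof
  assume le: "len (g \<otimes> s) \<le> len g"
  obtain w where w: "set w \<subseteq> S" "wp w = g" "length w = len g"
    using reduced_word_exists assms by blast
  obtain u a v where "w = u @ a # v" "wp (u @ v) = g \<otimes> s"
    using strong_exchange[OF w(1) assms(2)] w(2) le by blast
  then show "len (g \<otimes> s) < len g" using len_le[of "u @ v"] w by auto
qed simp

text \<open>
  Induction on the last position.  Its letter \<open>s\<close> ends no reduced word of \<open>g\<close> if \<open>s\<close>
  is not a right descent of \<open>g\<close>, so it is not used.  If \<open>s\<close> is a right descent, then it cannot be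
  skipped, and \<open>g s\<close> remains to be spelled by the earlier positions.
\<close>

lemma distinguished_unique:
  assumes "P \<subseteq> {..<k}" "k \<le> length Q" "g \<in> carrier G" "contains G S Q P g"
  shows "\<exists>!D. distinguished P D g"
  using assms
proof (induction k arbitrary: P g)
  case 0
  then have "P = {}" by simp
  with 0 show ?case by (auto simp: distinguished_def contains_def)
next
  case (Suc k)
  have kQ: "k < length Q" using Suc.prems by simp
  show ?case
  proof (cases "k \<in> P")
    case False
    then have "P \<subseteq> {..<k}" using Suc.prems(1) by (auto simp: less_Suc_eq subset_iff)
    then show ?thesis using Suc.IH Suc.prems by simp
  next
    case True
    define P' where "P' = P - {k}"
    have P: "P = insert k P'" "k \<notin> P'" and P': "P' \<subseteq> {..<k}"
      using True Suc.prems(1) by (auto simp: P'_def less_Suc_eq)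
    have P'Q: "P' \<subseteq> {..<length Q}" using P' kQ by fastforce
    obtain E where E: "E \<subseteq> P" "represents G S Q E g"
      using Suc.prems by (auto simp: contains_def)
    have at_k: "descends_at D k \<longleftrightarrow> len (g \<otimes> Q ! k) \<le> len g" if "D \<subseteq> P'" "represents G S Q D g" for D
    proof -
      have "D \<inter> {..<k} = D" using that P' by auto
      then show ?thesis using that by (simp add: descends_at_def represents_iff)
    qed
    show ?thesis
    proof (cases "len (g \<otimes> Q ! k) \<le> len g")
      case asc: False
      \<comment> \<open>a reduced word of \<open>g\<close> that ends in \<open>s\<close> makes \<open>g s\<close> shorter than \<open>g\<close>\<close>
      have notin: "k \<notin> D" if "D \<subseteq> P" "represents G S Q D g" for D
      proof
        assume "k \<in> D"
        have "D \<inter> {k<..} = {}" using that P P' by fastforce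
        then have "g = W (D - {k}) \<otimes> Q ! k"
          using W_split[OF \<open>k \<in> D\<close> kQ] W_remove[of D k] that kQ by (simp add: represents_iff)
        then have "g \<otimes> Q ! k = W (D - {k})"
          using kQ by simp
        moreover have "len (W (D - {k})) \<le> card (D - {k})"
          using that by (intro len_W_le) (auto simp: represents_iff)
        moreover have "card (D - {k}) \<le> card D"
          using that finite_subset by (intro card_mono) (auto simp: represents_iff)
        ultimately show False using asc that by (auto simp: represents_iff)
      qed
      then have "distinguished P D g \<longleftrightarrow> distinguished P' D g" for D
        using at_k asc P unfolding distinguished_def by blast
      moreover have "contains G S Q P' g"
        using E notin P P'Q by (auto simp: contains_def)
      ultimately show ?thesis using Suc.IH[OF P'] Suc.prems kQ by simp
    next
      case desc: True
      let ?h = "g \<otimes> Q ! k"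
      have less: "len ?h < len g" using desc descent_iff Suc.prems kQ by simp
      \<comment> \<open>drop a final \<open>s\<close> from a reduced word of \<open>g\<close>, or the letter that \<open>s\<close> can be exchanged for\<close>
      have "contains G S Q P' ?h"
      proof (cases "k \<in> E")
        case True
        then have E': "E = insert k (E - {k})" "E - {k} \<subseteq> P'" using E P by auto
        then have "represents G S Q (E - {k}) ?h"
          using represents_insert_last[of "E - {k}" k g] E P' kQ less Suc.prems by auto
        then show ?thesis using E' P'Q by (auto simp: contains_def)
      next
        case False
        then have E': "E \<subseteq> P'" "E \<subseteq> {..<length Q}" "finite E"
          using E P finite_subset[of E "{..<length Q}"] by (auto simp: represents_iff)
        have "descends_at E k" using at_k E' E desc by blast
        then obtain j where j: "j \<in> E" "j < k" "W (insert k E - {j}) = g"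
          using exchange_before[OF E(2) kQ False] by blast
        have "insert k E - {j} = insert k (E - {j})" using j by auto
        moreover have "card (insert k (E - {j})) = card E"
          using j E' False card_Suc_Diff1[of E j] by simp
        ultimately have "represents G S Q (insert k (E - {j})) g"
          using j E E' kQ by (auto simp: represents_iff)
        then have "represents G S Q (E - {j}) ?h"
          using represents_insert_last[of "E - {j}" k g] E' P' kQ less Suc.prems by auto
        then show ?thesis using E' P'Q unfolding contains_def by blast
      qed
      then have ex1: "\<exists>!D. distinguished P' D ?h"
        using Suc.IH[OF P'] Suc.prems kQ by simp
      have same: "descends_at (insert k D) i \<longleftrightarrow> descends_at D i" if "i < k" for D i
        using that by (simp add: descends_at_def Int_insert_left)
      have ins: "distinguished P (insert k D) g \<longleftrightarrow> distinguished P' D ?h" if "D \<subseteq> P'" for D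
      proof -
        have "represents G S Q (insert k D) g \<longleftrightarrow> represents G S Q D ?h"
          using represents_insert_last[of D k g] that P' kQ less Suc.prems by auto
        moreover have "P - insert k D = P' - D" using P that by auto
        moreover have "\<forall>i\<in>P' - D. i < k" using P' by auto
        ultimately show ?thesis using that P same unfolding distinguished_def by blast
      qed
      \<comment> \<open>otherwise \<open>k\<close> would be a descent that is skipped\<close>
      have k_in: "k \<in> D" if "distinguished P D g" for D
        using that at_k[of D] desc P unfolding distinguished_def by blast
      from ex1 obtain D0 where D0: "distinguished P' D0 ?h"
        and uniq: "\<And>D. distinguished P' D ?h \<Longrightarrow> D = D0" by blast
      show ?thesis
      proof (rule ex1I[of _ "insert k D0"])
        show "distinguished P (insert k D0) g" using ins D0 by (simp add: distinguished_def)
        fix D assume D: "distinguished P D g"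
        then have "D = insert k (D - {k})" "D - {k} \<subseteq> P'"
          using k_in P by (auto simp: distinguished_def)
        then show "D = insert k D0" using ins[of "D - {k}"] D uniq by metis
      qed
    qed
  qed
qed

end

section \<open>K-polynomials of simplicial complexes\<close>

lemma series_mult_diff_right:
  fixes p q :: "int mpoly"
  shows
  "series_mult f (Poly_Mapping.lookup (p - q)) e = series_mult f (Poly_Mapping.lookup p) e - series_mult f (Poly_Mapping.lookup q) e"
  by (simp add: series_mult_def lookup_minus right_diff_distrib case_prod_unfold flip: sum_subtractf)

lemma series_mult_diff_left:
  "series_mult (\<lambda>e. f e - g e) h e = series_mult f h e - series_mult g h e"
  by (simp add: series_mult_def left_diff_distrib case_prod_unfold sum_subtractf)

lemma series_mult_sum_left:
  "series_mult (\<lambda>e. \<Sum>x\<in>X. f x e) h e = (\<Sum>x\<in>X. series_mult (f x) h e)"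
  unfolding series_mult_def case_prod_unfold sum_distrib_right by (rule sum.swap)

lemma series_mult_monomial:
  "series_mult f (Poly_Mapping.lookup (Poly_Mapping.single c 1)) e = (if \<exists>a. e = a + c then f (e - c) else 0)"
proof -
  have "series_mult f (Poly_Mapping.lookup (Poly_Mapping.single c 1)) e
      = (\<Sum>x \<in> {(a, b). a + b = e}. if x = (e - c, c) then f (e - c) else 0)"
    unfolding series_mult_def by (rule sum.cong) (auto simp: lookup_single when_def split: if_splits)
  also have "\<dots> = (if (e - c, c) \<in> {(a, b). a + b = e} then f (e - c) else 0)"
    using finite_antidiagonal[of e] by (simp add: sum.delta)
  also have "\<dots> = (if \<exists>a. e = a + c then f (e - c) else 0)"
    by (auto intro!: if_cong) (metis add_diff_cancel_right')
  finally show ?thesis .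
qed

lemma series_mult_zero_right: "series_mult f (Poly_Mapping.lookup (0 :: int mpoly)) = (\<lambda>e. 0)"
  unfolding series_mult_def case_prod_unfold by simp

text \<open>
  Both sides are additive in \<open>p\<close> and \<open>q\<close>, so it is enough to look at monomials, for which
  multiplication is a shift of the exponents.  The left factor is an arbitrary power series and is
  never decomposed.
\<close>

lemma series_mult_assoc:
  fixes p q :: "int mpoly"
  shows
  "series_mult (series_mult f (Poly_Mapping.lookup p)) (Poly_Mapping.lookup q) = series_mult f (Poly_Mapping.lookup (p * q))"
proof -
  have mono: "series_mult (series_mult f (Poly_Mapping.lookup (frag_of c))) (Poly_Mapping.lookup (frag_of d))
      = series_mult f (Poly_Mapping.lookup (frag_of c * frag_of d))" for c d :: "nat \<Rightarrow>\<^sub>0 nat"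
  proof
    fix e
    have "(\<exists>a. e = a + (c + d)) \<longleftrightarrow> (\<exists>a. e = a + d) \<and> (\<exists>a. e - d = a + c)"
      by (auto simp: add.assoc[symmetric])
    then show "series_mult (series_mult f (Poly_Mapping.lookup (frag_of c))) (Poly_Mapping.lookup (frag_of d)) e
        = series_mult f (Poly_Mapping.lookup (frag_of c * frag_of d)) e"
      by (auto simp: series_mult_monomial mult_single add.commute diff_diff_add simp del: lookup_frag_of)
  qed
  have left: "series_mult (series_mult f (Poly_Mapping.lookup p)) (Poly_Mapping.lookup (frag_of d))
      = series_mult f (Poly_Mapping.lookup (p * frag_of d))" for d :: "nat \<Rightarrow>\<^sub>0 nat"
  proof (rule frag_induction[of p UNIV])
    show "series_mult (series_mult f (Poly_Mapping.lookup 0)) (Poly_Mapping.lookup (frag_of d))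
        = series_mult f (Poly_Mapping.lookup (0 * frag_of d))"
      unfolding mult_zero_left series_mult_zero_right by (simp add: series_mult_def fun_eq_iff)
  next
    fix a b :: "int mpoly"
    assume *: "series_mult (series_mult f (Poly_Mapping.lookup a)) (Poly_Mapping.lookup (frag_of d))
        = series_mult f (Poly_Mapping.lookup (a * frag_of d))"
      "series_mult (series_mult f (Poly_Mapping.lookup b)) (Poly_Mapping.lookup (frag_of d))
        = series_mult f (Poly_Mapping.lookup (b * frag_of d))"
    have ab: "series_mult f (Poly_Mapping.lookup (a - b))
        = (\<lambda>e. series_mult f (Poly_Mapping.lookup a) e - series_mult f (Poly_Mapping.lookup b) e)"
      by (simp add: fun_eq_iff series_mult_diff_right)
    then show "series_mult (series_mult f (Poly_Mapping.lookup (a - b))) (Poly_Mapping.lookup (frag_of d))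
        = series_mult f (Poly_Mapping.lookup ((a - b) * frag_of d))"
      unfolding left_diff_distrib ab
      by (intro ext) (simp only: series_mult_diff_left series_mult_diff_right *)
  qed (rule subset_UNIV, rule mono)
  show ?thesis
  proof (rule frag_induction[of q UNIV])
    fix a b :: "int mpoly"
    assume "series_mult (series_mult f (Poly_Mapping.lookup p)) (Poly_Mapping.lookup a)
        = series_mult f (Poly_Mapping.lookup (p * a))"
      "series_mult (series_mult f (Poly_Mapping.lookup p)) (Poly_Mapping.lookup b)
        = series_mult f (Poly_Mapping.lookup (p * b))"
    then show "series_mult (series_mult f (Poly_Mapping.lookup p)) (Poly_Mapping.lookup (a - b))
        = series_mult f (Poly_Mapping.lookup (p * (a - b)))"
      by (simp add: fun_eq_iff right_diff_distrib series_mult_diff_right)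
  next
    show "series_mult (series_mult f (Poly_Mapping.lookup p)) (Poly_Mapping.lookup 0)
        = series_mult f (Poly_Mapping.lookup (p * 0))"
      unfolding mult_zero_right series_mult_zero_right ..
  qed (rule subset_UNIV, rule left)
qed

lemma series_mult_lookup: "series_mult (Poly_Mapping.lookup p) (Poly_Mapping.lookup q) = Poly_Mapping.lookup (p * q)"
  for p q :: "int mpoly"
proof -
  have one: "series_mult (Poly_Mapping.lookup (1 :: int mpoly)) g = g" for g
  proof
    fix e
    have "series_mult (Poly_Mapping.lookup (1 :: int mpoly)) g e = (\<Sum>x \<in> {(a, b). a + b = e}. if x = (0, e) then g e else 0)"
      unfolding series_mult_def by (rule sum.cong) (auto simp: lookup_one when_def split: if_splits)
    also have "\<dots> = g e" using finite_antidiagonal[of e] by (simp add: sum.delta)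
    finally show "series_mult (Poly_Mapping.lookup (1 :: int mpoly)) g e = g e" .
  qed
  show ?thesis using series_mult_assoc[of "Poly_Mapping.lookup (1 :: int mpoly)" p q] by (simp add: one)
qed

lemma lookup_sum_single: "finite F \<Longrightarrow>
    Poly_Mapping.lookup (\<Sum>i\<in>F. Poly_Mapping.single i (1::nat)) j = (if j \<in> F then 1 else 0)"
  by (simp add: lookup_sum lookup_single when_def)

lemma prod_zvar: "(\<Prod>i\<in>F. zvar i) = Poly_Mapping.single (\<Sum>i\<in>F. Poly_Mapping.single i 1) 1"
  by (induction F rule: infinite_finite_induct) (auto simp: zvar_def mult_single)

text \<open>
  For finite \<open>F\<close> and \<open>B \<subseteq> F\<close> this is the rational function \<open>(\<Prod>\<^sub>i\<^sub>\<in>\<^sub>F z\<^sub>i) / (\<Prod>\<^sub>i\<^sub>\<in>\<^sub>F\<^sub>-\<^sub>B (1 - z\<^sub>i))\<close>: the exponents in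
  \<open>F - B\<close> run freely through the positive integers and those in \<open>B\<close> are fixed to 1.  The set \<open>B\<close>
  records the denominators that have been cleared.
\<close>

definition support_series :: "nat set \<Rightarrow> nat set \<Rightarrow> (nat \<Rightarrow>\<^sub>0 nat) \<Rightarrow> int" where
  "support_series F B e = (if Poly_Mapping.keys e = F \<and> (\<forall>i\<in>B. Poly_Mapping.lookup e i = 1) then 1 else 0)"

text \<open>
  Subtracting the shift by \<open>z\<^sub>i\<close> telescopes: all monomials with exponent at least 2 at \<open>i\<close> cancel.
\<close>

lemma support_series_step:
  assumes "i \<in> F" "i \<notin> B"
  shows "series_mult (support_series F B) (Poly_Mapping.lookup (1 - zvar i)) = support_series F (insert i B)"
proof
  fix e :: "nat \<Rightarrow>\<^sub>0 nat"
  let ?c = "Poly_Mapping.single i (1::nat)"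
  have eq: "series_mult (support_series F B) (Poly_Mapping.lookup (1 - zvar i)) e
      = support_series F B e - (if \<exists>a. e = a + ?c then support_series F B (e - ?c) else 0)"
    using series_mult_monomial[of "support_series F B" 0 e]
    by (simp add: series_mult_diff_right zvar_def series_mult_monomial del: lookup_frag_of)
  show "series_mult (support_series F B) (Poly_Mapping.lookup (1 - zvar i)) e = support_series F (insert i B) e"
  proof (cases "Poly_Mapping.lookup e i")
    case 0
    then have "i \<notin> Poly_Mapping.keys e" by (simp add: in_keys_iff)
    moreover have "\<not> (\<exists>a. e = a + ?c)" using 0 by (auto simp: lookup_add)
    ultimately show ?thesis using assms unfolding eq by (auto simp: support_series_def)
  next
    case (Suc n)
    define a where "a = e - ?c"
    have e: "e = a + ?c"
      by (rule poly_mapping_eqI) (use Suc in \<open>auto simp: a_def lookup_add lookup_minus lookup_single when_def\<close>)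
    have a: "Poly_Mapping.lookup a j = (if j = i then n else Poly_Mapping.lookup e j)" for j
      using Suc by (auto simp: a_def lookup_minus lookup_single when_def)
    show ?thesis
    proof (cases n)
      case 0
      then have "i \<notin> Poly_Mapping.keys a" using a by (simp add: in_keys_iff)
      then have "support_series F B a = 0" using assms by (auto simp: support_series_def)
      then show ?thesis using e 0 Suc unfolding eq a_def[symmetric]
        by (auto simp: support_series_def)
    next
      case (Suc k)
      have "Poly_Mapping.keys a = Poly_Mapping.keys e"
        using a Suc \<open>Poly_Mapping.lookup e i = Suc n\<close> by (auto simp: in_keys_iff split: if_splits)
      moreover have "Poly_Mapping.lookup a j = Poly_Mapping.lookup e j" if "j \<in> B" for j
        using a[of j] that assms(2) by auto
      ultimately have "support_series F B a = support_series F B e"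
        by (simp add: support_series_def)
      moreover have "support_series F (insert i B) e = 0"
        using Suc \<open>Poly_Mapping.lookup e i = Suc n\<close> by (simp add: support_series_def)
      ultimately show ?thesis using e unfolding eq a_def[symmetric] by auto
    qed
  qed
qed


lemma support_series_times_prod:
  assumes "finite F"
  shows "series_mult (support_series F {}) (Poly_Mapping.lookup (\<Prod>i\<in>F. 1 - zvar i))
       = Poly_Mapping.lookup (\<Prod>i\<in>F. zvar i)"
proof -
  have "series_mult (support_series F {}) (Poly_Mapping.lookup (\<Prod>i\<in>B. 1 - zvar i))
      = support_series F B" if "B \<subseteq> F" for B
    using finite_subset[OF that assms] that
  proof (induction B rule: finite_induct)
    case empty
    then show ?case
      using series_mult_monomial[of "support_series F {}" 0] by (auto simp: fun_eq_iff simp del: lookup_frag_of)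
  next
    case (insert i B)
    then show ?case
      using support_series_step[of i F B] series_mult_assoc[of "support_series F {}" "\<Prod>i\<in>B. 1 - zvar i" "1 - zvar i"]
      by (simp add: mult.commute)
  qed
  moreover have "support_series F F = Poly_Mapping.lookup (\<Prod>i\<in>F. zvar i)"
  proof
    fix e :: "nat \<Rightarrow>\<^sub>0 nat"
    let ?m = "\<Sum>i\<in>F. Poly_Mapping.single i (1::nat)"
    have "Poly_Mapping.keys e = F \<and> (\<forall>i\<in>F. Poly_Mapping.lookup e i = 1) \<longleftrightarrow> ?m = e"
    proof
      assume "Poly_Mapping.keys e = F \<and> (\<forall>i\<in>F. Poly_Mapping.lookup e i = 1)"
      then show "?m = e"
        by (intro poly_mapping_eqI) (auto simp: lookup_sum_single[OF assms] in_keys_iff simp del: One_nat_def)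
    next
      assume "?m = e"
      then have "Poly_Mapping.lookup e j = (if j \<in> F then 1 else 0)" for j
        using lookup_sum_single[OF assms] by metis
      then show "Poly_Mapping.keys e = F \<and> (\<forall>i\<in>F. Poly_Mapping.lookup e i = 1)"
        by (auto simp: in_keys_iff split: if_splits)
    qed
    then show "support_series F F e = Poly_Mapping.lookup (\<Prod>i\<in>F. zvar i) e"
      by (simp add: support_series_def prod_zvar lookup_single when_def)
  qed
  ultimately show ?thesis by simp
qed

lemma poly_ring_simps [simp]:
  "mult (poly_ring m) = (*)" "one (poly_ring m) = 1" "zero (poly_ring m) = 0"
  "add (poly_ring m) = (+)"
  "p \<in> carrier (poly_ring m) \<longleftrightarrow> (\<forall>e\<in>Poly_Mapping.keys p. Poly_Mapping.keys e \<subseteq> {..<m})"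
  by (simp_all add: poly_ring_def)

lemma keys_add_exponents: "Poly_Mapping.keys (a + b) = Poly_Mapping.keys a \<union> Poly_Mapping.keys b"
  for a b :: "nat \<Rightarrow>\<^sub>0 nat"
  by (auto simp: in_keys_iff lookup_add)

lemma keys_mult_exponents:
  fixes p q :: "'k::field mpoly"
  assumes "e \<in> Poly_Mapping.keys (p * q)"
  obtains a b where "a \<in> Poly_Mapping.keys p" "b \<in> Poly_Mapping.keys q"
    "Poly_Mapping.keys e = Poly_Mapping.keys a \<union> Poly_Mapping.keys b"
  using assms keys_mult[of p q] keys_add_exponents by blast

lemma ring_poly_ring: "ring (poly_ring m :: 'k::field mpoly ring)"
proof (rule ringI)
  show "abelian_group (poly_ring m :: 'k mpoly ring)"
  proof (rule abelian_groupI)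
    fix x y :: "'k mpoly"
    assume "x \<in> carrier (poly_ring m)" "y \<in> carrier (poly_ring m)"
    then show "x \<oplus>\<^bsub>poly_ring m\<^esub> y \<in> carrier (poly_ring m)"
      using keys_add[of x y] by auto
  next
    fix x :: "'k mpoly"
    assume "x \<in> carrier (poly_ring m)"
    then show "\<exists>y\<in>carrier (poly_ring m). y \<oplus>\<^bsub>poly_ring m\<^esub> x = \<zero>\<^bsub>poly_ring m\<^esub>"
      by (intro bexI[of _ "- x"]) (auto simp: in_keys_iff)
  qed (auto simp: add.assoc add.commute)
  show "monoid (poly_ring m :: 'k mpoly ring)"
  proof (rule monoidI)
    fix x y :: "'k mpoly"
    assume "x \<in> carrier (poly_ring m)" "y \<in> carrier (poly_ring m)"
    then show "x \<otimes>\<^bsub>poly_ring m\<^esub> y \<in> carrier (poly_ring m)"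
      by (auto elim!: keys_mult_exponents) blast+
  qed (auto simp: mult.assoc)
qed (auto simp: algebra_simps)

text \<open>
  The polynomials whose monomials all have non-faces as supports form an ideal that contains the
  generators, and no monomial supported on a face belongs to it.  Conversely a
  monomial is a multiple of the squarefree monomial on its support.
\<close>

lemma single_in_stanley_reisner_ideal_iff:
  assumes down: "\<And>F F'. F \<in> \<Delta> \<Longrightarrow> F' \<subseteq> F \<Longrightarrow> F' \<in> \<Delta>"
    and e: "Poly_Mapping.keys e \<subseteq> {..<m}"
  shows "Poly_Mapping.single e 1 \<in> (stanley_reisner_ideal m \<Delta> :: 'k::field mpoly set)
     \<longleftrightarrow> Poly_Mapping.keys e \<notin> \<Delta>"
proof -
  let ?R = "poly_ring m :: 'k mpoly ring"
  let ?gens = "{\<Prod>i\<in>D. zvar i | D. D \<subseteq> {..<m} \<and> D \<notin> \<Delta>} :: 'k mpoly set"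
  interpret ring ?R by (rule ring_poly_ring)
  have keys_gen: "Poly_Mapping.keys (\<Sum>i\<in>D. Poly_Mapping.single i (1::nat)) = D" if "D \<subseteq> {..<m}" for D
    using lookup_sum_single[OF finite_subset[OF that]] by (auto simp: in_keys_iff split: if_splits)
  show ?thesis
  proof
    define J where "J = {p \<in> carrier ?R. \<forall>a\<in>Poly_Mapping.keys p. Poly_Mapping.keys a \<notin> \<Delta>}"
    have "ideal J ?R"
    proof (rule idealI)
      show "subgroup J (add_monoid ?R)"
      proof (rule add.subgroupI)
        fix x assume x: "x \<in> J"
        then have "\<ominus>\<^bsub>?R\<^esub> x = - x"
          by (intro minus_equality) (auto simp: J_def in_keys_iff)
        then show "\<ominus>\<^bsub>?R\<^esub> x \<in> J" using x by (auto simp: J_def in_keys_iff)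
      next
        fix x y assume "x \<in> J" "y \<in> J"
        moreover have "a \<in> Poly_Mapping.keys x \<or> a \<in> Poly_Mapping.keys y"
          if "a \<in> Poly_Mapping.keys (x + y)" for a
          using that keys_add[of x y] by blast
        ultimately show "x \<oplus>\<^bsub>?R\<^esub> y \<in> J" unfolding J_def poly_ring_simps mem_Collect_eq by meson
      next
        have "0 \<in> J" by (simp add: J_def)
        then show "J \<noteq> {}" by blast
      qed (auto simp: J_def)
    next
      fix p x assume p: "p \<in> J" and x: "x \<in> carrier ?R"
      then have *: "Poly_Mapping.keys a \<notin> \<Delta> \<and> Poly_Mapping.keys a \<subseteq> {..<m}"
        if a: "a \<in> Poly_Mapping.keys (p * x)" for a
      proof -
        obtain b c where b: "b \<in> Poly_Mapping.keys p" and c: "c \<in> Poly_Mapping.keys x"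
          and keys_a: "Poly_Mapping.keys a = Poly_Mapping.keys b \<union> Poly_Mapping.keys c"
          using a by (rule keys_mult_exponents)
        have "Poly_Mapping.keys b \<notin> \<Delta>" "Poly_Mapping.keys b \<subseteq> {..<m}" "Poly_Mapping.keys c \<subseteq> {..<m}"
          using p x b c by (auto simp: J_def)
        then show ?thesis using down[of "Poly_Mapping.keys a" "Poly_Mapping.keys b"] keys_a by auto
      qed
      then show "x \<otimes>\<^bsub>?R\<^esub> p \<in> J" "p \<otimes>\<^bsub>?R\<^esub> x \<in> J"
        by (auto simp: J_def mult.commute)
    qed (rule ring_poly_ring)
    moreover have "?gens \<subseteq> J"
    proof
      fix p assume "p \<in> ?gens"
      then obtain D where "D \<subseteq> {..<m}" "D \<notin> \<Delta>" "p = (\<Prod>i\<in>D. zvar i)" by blast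
      then show "p \<in> J" using keys_gen[of D] by (simp add: J_def prod_zvar)
    qed
    ultimately have "Idl\<^bsub>?R\<^esub> ?gens \<subseteq> J" by (rule genideal_minimal)
    moreover assume "Poly_Mapping.single e 1 \<in> (stanley_reisner_ideal m \<Delta> :: 'k mpoly set)"
    ultimately have "Poly_Mapping.single e 1 \<in> J" by (auto simp: stanley_reisner_ideal_def)
    then show "Poly_Mapping.keys e \<notin> \<Delta>" by (simp add: J_def)
  next
    assume nf: "Poly_Mapping.keys e \<notin> \<Delta>"
    have gens: "?gens \<subseteq> carrier ?R" using keys_gen by (auto simp: prod_zvar)
    interpret I: ideal "stanley_reisner_ideal m \<Delta>" ?R
      unfolding stanley_reisner_ideal_def by (rule genideal_ideal[OF gens])
    let ?s = "\<Sum>i\<in>Poly_Mapping.keys e. Poly_Mapping.single i (1::nat)"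
    have gen: "(\<Prod>i\<in>Poly_Mapping.keys e. zvar i) \<in> (stanley_reisner_ideal m \<Delta> :: 'k mpoly set)"
      unfolding stanley_reisner_ideal_def
      by (rule subsetD[OF genideal_self[OF gens]]) (use nf e in blast)
    have es: "?s + (e - ?s) = e"
      by (rule poly_mapping_eqI)
        (auto simp: lookup_add lookup_minus lookup_sum_single in_keys_iff simp del: One_nat_def)
    have "Poly_Mapping.keys (e - ?s) \<subseteq> {..<m}"
      using e keys_add_exponents[of ?s "e - ?s"] unfolding es by blast
    then have "(\<Prod>i\<in>Poly_Mapping.keys e. zvar i) * Poly_Mapping.single (e - ?s) 1
        \<in> (stanley_reisner_ideal m \<Delta> :: 'k mpoly set)"
      using I.I_r_closed[OF gen, of "Poly_Mapping.single (e - ?s) 1"] by simp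
    then show "Poly_Mapping.single e 1 \<in> (stanley_reisner_ideal m \<Delta> :: 'k mpoly set)"
      using es by (simp add: prod_zvar mult_single)
  qed
qed

text \<open>
  The Hilbert series is the sum of the \<open>support_series\<close> of the faces.  For a face \<open>F\<close>, the factors
  \<open>1 - z\<^sub>i\<close> with \<open>i \<in> F\<close> clear the denominators, and the other factors stay.
\<close>

lemma K_polynomial_of_complex:
  assumes down: "\<And>F F'. F \<in> \<Delta> \<Longrightarrow> F' \<subseteq> F \<Longrightarrow> F' \<in> \<Delta>"
    and sub: "\<And>F. F \<in> \<Delta> \<Longrightarrow> F \<subseteq> {..<m}"
  shows "is_K_polynomial m (stanley_reisner_ideal m \<Delta> :: 'k::field mpoly set)
     (\<Sum>F\<in>\<Delta>. (\<Prod>i\<in>F. zvar i) * (\<Prod>i\<in>{..<m} - F. 1 - zvar i))"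
proof -
  have fin: "finite \<Delta>" using sub finite_subset[of \<Delta> "Pow {..<m}"] by blast
  have hilb: "hilbert_series m (stanley_reisner_ideal m \<Delta> :: 'k mpoly set)
      = (\<lambda>e. \<Sum>F\<in>\<Delta>. support_series F {} e)"
  proof
    fix e
    have "(\<Sum>F\<in>\<Delta>. support_series F {} e) = (if Poly_Mapping.keys e \<in> \<Delta> then 1 else 0)"
      using fin by (simp add: support_series_def)
    then show "hilbert_series m (stanley_reisner_ideal m \<Delta> :: 'k mpoly set) e
        = (\<Sum>F\<in>\<Delta>. support_series F {} e)"
      using single_in_stanley_reisner_ideal_iff[of \<Delta> e m, where 'k = 'k] down sub
      by (auto simp: hilbert_series_def)
  qed
  have "series_mult (support_series F {}) (Poly_Mapping.lookup (\<Prod>i<m. 1 - zvar i))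
      = Poly_Mapping.lookup ((\<Prod>i\<in>F. zvar i) * (\<Prod>i\<in>{..<m} - F. 1 - zvar i))" if "F \<in> \<Delta>" for F
  proof -
    have "(\<Prod>i<m. 1 - zvar i) = (\<Prod>i\<in>F. 1 - zvar i) * (\<Prod>i\<in>{..<m} - F. (1 - zvar i :: int mpoly))"
      using prod.subset_diff[OF sub[OF that], of "\<lambda>i. 1 - zvar i"] by (simp add: mult.commute)
    then show ?thesis
      using support_series_times_prod[of F] sub[OF that] finite_subset[of F "{..<m}"]
      by (simp add: series_mult_lookup flip: series_mult_assoc)
  qed
  then show ?thesis
    unfolding is_K_polynomial_def hilb
    by (simp add: fun_eq_iff series_mult_sum_left lookup_sum)
qed

section \<open>Partitions into intervals\<close>

lemma interval_expansion:
  fixes x :: "'i \<Rightarrow> 'c::comm_ring_1"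
  assumes "finite U" "D \<subseteq> U" "A \<subseteq> U - D"
  shows "(\<Prod>i\<in>D. 1 - x i) * (\<Prod>i\<in>A. x i)
       = (\<Sum>P | D \<subseteq> P \<and> P \<subseteq> U - A. (\<Prod>i\<in>P. 1 - x i) * (\<Prod>i\<in>U - P. x i))"
proof -
  let ?R = "U - D - A"
  have fin: "finite D" "finite A" "finite ?R"
    using assms finite_subset[of _ U] by blast+
  have "(\<Prod>i\<in>D. 1 - x i) * (\<Prod>i\<in>A. x i)
      = (\<Prod>i\<in>D. 1 - x i) * (\<Prod>i\<in>A. x i) * (\<Prod>i\<in>?R. (1 - x i) + x i)" by simp
  also have "\<dots> = (\<Sum>X\<in>Pow ?R. ((\<Prod>i\<in>D. 1 - x i) * (\<Prod>i\<in>A. x i))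
      * ((\<Prod>i\<in>X. 1 - x i) * (\<Prod>i\<in>?R - X. x i)))"
    by (subst prod_add[OF fin(3)]) (rule sum_distrib_left)
  also have "\<dots> = (\<Sum>P | D \<subseteq> P \<and> P \<subseteq> U - A. (\<Prod>i\<in>P. 1 - x i) * (\<Prod>i\<in>U - P. x i))"
  proof (rule sum.reindex_bij_witness[of _ "\<lambda>P. P - D" "\<lambda>X. D \<union> X"])
    fix X assume X: "X \<in> Pow ?R"
    have "U - (D \<union> X) = A \<union> (?R - X)" using X assms by auto
    moreover have "(\<Prod>i\<in>A \<union> (?R - X). x i) = (\<Prod>i\<in>A. x i) * (\<Prod>i\<in>?R - X. x i)"
      using fin by (intro prod.union_disjoint) auto
    moreover have "(\<Prod>i\<in>D \<union> X. 1 - x i) = (\<Prod>i\<in>D. 1 - x i) * (\<Prod>i\<in>X. 1 - x i)"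
      using fin X finite_subset[of X ?R] by (intro prod.union_disjoint) auto
    ultimately show "(\<Prod>i\<in>D \<union> X. 1 - x i) * (\<Prod>i\<in>U - (D \<union> X). x i)
        = ((\<Prod>i\<in>D. 1 - x i) * (\<Prod>i\<in>A. x i)) * ((\<Prod>i\<in>X. 1 - x i) * (\<Prod>i\<in>?R - X. x i))"
      by (simp add: mult_ac)
  qed (use assms in auto)
  finally show ?thesis .
qed

lemma sum_interval_partition:
  fixes x :: "'i \<Rightarrow> 'c::comm_ring_1"
  assumes fin: "finite U" and DU: "\<And>D. D \<in> \<D> \<Longrightarrow> D \<subseteq> U \<and> A D \<subseteq> U - D"
    and up: "\<And>D P. D \<in> \<D> \<Longrightarrow> D \<subseteq> P \<Longrightarrow> P \<subseteq> U - A D \<Longrightarrow> P \<in> \<P>"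
    and unique: "\<And>P. P \<in> \<P> \<Longrightarrow> \<exists>!D. D \<in> \<D> \<and> D \<subseteq> P \<and> P \<subseteq> U - A D"
  shows "(\<Sum>D\<in>\<D>. (\<Prod>i\<in>D. 1 - x i) * (\<Prod>i\<in>A D. x i))
       = (\<Sum>P\<in>\<P>. (\<Prod>i\<in>P. 1 - x i) * (\<Prod>i\<in>U - P. x i))"
proof -
  let ?I = "\<lambda>D. {P. D \<subseteq> P \<and> P \<subseteq> U - A D}"
  have finD: "finite \<D>" using DU finite_subset[of \<D> "Pow U"] fin by blast
  have "(\<Sum>D\<in>\<D>. (\<Prod>i\<in>D. 1 - x i) * (\<Prod>i\<in>A D. x i))
      = (\<Sum>D\<in>\<D>. \<Sum>P\<in>?I D. (\<Prod>i\<in>P. 1 - x i) * (\<Prod>i\<in>U - P. x i))"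
    using fin DU by (intro sum.cong interval_expansion) auto
  also have "\<dots> = (\<Sum>P\<in>(\<Union>D\<in>\<D>. ?I D). (\<Prod>i\<in>P. 1 - x i) * (\<Prod>i\<in>U - P. x i))"
  proof (rule sum.UNION_disjoint[symmetric])
    show "\<forall>D\<in>\<D>. finite (?I D)"
      using fin by (auto intro: finite_subset[of _ "Pow U"])
    have "D = D'" if "D \<in> \<D>" "D' \<in> \<D>" "P \<in> ?I D" "P \<in> ?I D'" for D D' P
    proof -
      have "P \<in> \<P>" using up[OF that(1)] that(3) by simp
      from unique[OF this] show ?thesis using that by (auto elim!: ex1E)
    qed
    then show "\<forall>D\<in>\<D>. \<forall>D'\<in>\<D>. D \<noteq> D' \<longrightarrow> ?I D \<inter> ?I D' = {}" by blast
  qed fact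
  also have "(\<Union>D\<in>\<D>. ?I D) = \<P>"
  proof
    show "(\<Union>D\<in>\<D>. ?I D) \<subseteq> \<P>" using up by auto
    show "\<P> \<subseteq> (\<Union>D\<in>\<D>. ?I D)" using ex1_implies_ex[OF unique] by blast
  qed
  finally show ?thesis .
qed

section \<open>Faces and facets of the subword complex\<close>

context subwords
begin

lemma represents_contains:
  assumes "represents G S Q D g" "D \<subseteq> P" "P \<subseteq> {..<length Q}"
  shows "contains G S Q P g"
  using assms by (auto simp: contains_def)

lemma subword_complex_eq:
  "subword_complex G S Q g = (\<lambda>P. {..<length Q} - P) ` {P. contains G S Q P g}"
  by (auto simp: subword_complex_def)

text \<open>
  All subwords that represent \<open>g\<close> have the same number of letters, so none of them
  properly contains another.
\<close>

lemma facets_subword_complex: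
  "facets (subword_complex G S Q g) = (\<lambda>D. {..<length Q} - D) ` {D. represents G S Q D g}"
proof (intro equalityI subsetI)
  let ?U = "{..<length Q}"
  fix F assume F: "F \<in> facets (subword_complex G S Q g)"
  then obtain P where P: "F = ?U - P" "contains G S Q P g"
    by (auto simp: facets_def subword_complex_eq)
  then obtain D where D: "D \<subseteq> P" "represents G S Q D g" by (auto simp: contains_def)
  then have "?U - D \<in> subword_complex G S Q g"
    using represents_contains[OF D(2)] by (auto simp: subword_complex_eq represents_iff)
  then have "?U - D = F" using F P D by (auto simp: facets_def)
  then show "F \<in> (\<lambda>D. ?U - D) ` {D. represents G S Q D g}" using D by auto
next
  let ?U = "{..<length Q}"
  fix F assume "F \<in> (\<lambda>D. ?U - D) ` {D. represents G S Q D g}"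
  then obtain D where D: "F = ?U - D" "represents G S Q D g" by auto
  have DU: "D \<subseteq> ?U" using D by (simp add: represents_iff)
  have "F' = F" if F': "F' \<in> subword_complex G S Q g" "F \<subseteq> F'" for F'
  proof -
    obtain P where P: "F' = ?U - P" "contains G S Q P g"
      using F' by (auto simp: subword_complex_eq)
    then obtain E where E: "E \<subseteq> P" "represents G S Q E g" by (auto simp: contains_def)
    have "P \<subseteq> ?U" using P by (simp add: contains_def)
    then have PD: "P \<subseteq> D" using F' P D by auto
    have "card E = card D" "finite D"
      using D E finite_subset[OF DU] by (auto simp: represents_iff)
    then have "E = D" using card_subset_eq[of D E] E PD by auto
    then show ?thesis using P D E PD by auto
  qed
  moreover have "F \<in> subword_complex G S Q g"
    using represents_contains[OF D(2)] DU D by (auto simp: subword_complex_eq)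
  ultimately show "F \<in> facets (subword_complex G S Q g)" by (auto simp: facets_def)
qed

lemma abs_set_eq:
  "represents G S Q D g \<Longrightarrow> abs_set G S Q D = {i \<in> {..<length Q} - D. descends_at D i}"
  by (auto simp: abs_set_def absorbable_iff_descends)

lemma unique_interval:
  assumes "g \<in> carrier G" "contains G S Q P g"
  shows "\<exists>!D. D \<in> {D. represents G S Q D g} \<and> D \<subseteq> P \<and> P \<subseteq> {..<length Q} - abs_set G S Q D"
proof -
  have P: "P \<subseteq> {..<length Q}" using assms by (simp add: contains_def)
  then have "distinguished P D g \<longleftrightarrow>
      D \<in> {D. represents G S Q D g} \<and> D \<subseteq> P \<and> P \<subseteq> {..<length Q} - abs_set G S Q D" for D
    by (cases "represents G S Q D g") (auto simp: distinguished_def abs_set_eq)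
  then show ?thesis using distinguished_unique[OF P order_refl assms] by simp
qed

lemma sum_facets_eq_sum_faces:
  fixes x :: "nat \<Rightarrow> 'c::comm_ring_1"
  assumes g: "g \<in> carrier G"
  defines "U \<equiv> {..<length Q}" and "\<Delta> \<equiv> subword_complex G S Q g"
  shows "(\<Sum>F\<in>facets \<Delta>. (\<Prod>i\<in>U - F. 1 - x i) * (\<Prod>i\<in>abs_set G S Q (U - F). x i))
       = (\<Sum>F\<in>\<Delta>. (\<Prod>i\<in>F. x i) * (\<Prod>i\<in>U - F. 1 - x i))"
proof -
  let ?\<D> = "{D. represents G S Q D g}" and ?\<P> = "{P. contains G S Q P g}"
  have D: "U - (U - D) = D" if "D \<in> ?\<D>" for D using that by (auto simp: represents_iff U_def)
  have P: "U - (U - P) = P" if "P \<in> ?\<P>" for P using that by (auto simp: contains_def U_def)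
  have "(\<Sum>F\<in>facets \<Delta>. (\<Prod>i\<in>U - F. 1 - x i) * (\<Prod>i\<in>abs_set G S Q (U - F). x i))
      = (\<Sum>D\<in>?\<D>. (\<Prod>i\<in>D. 1 - x i) * (\<Prod>i\<in>abs_set G S Q D. x i))"
  proof (rule sum.reindex_cong)
    show "facets \<Delta> = (\<lambda>D. U - D) ` ?\<D>"
      by (simp add: \<Delta>_def U_def facets_subword_complex)
    show "inj_on (\<lambda>D. U - D) ?\<D>" using D by (rule inj_on_inverseI)
  qed (simp add: D)
  also have "\<dots> = (\<Sum>P\<in>?\<P>. (\<Prod>i\<in>P. 1 - x i) * (\<Prod>i\<in>U - P. x i))"
  proof (rule sum_interval_partition)
    fix P assume "P \<in> ?\<P>"
    then show "\<exists>!D. D \<in> ?\<D> \<and> D \<subseteq> P \<and> P \<subseteq> U - abs_set G S Q D"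
      using unique_interval[OF g] by (simp add: U_def)
  next
    fix D P assume "D \<in> ?\<D>" "D \<subseteq> P" "P \<subseteq> U - abs_set G S Q D"
    then show "P \<in> ?\<P>" using represents_contains[of D g P] by (auto simp: U_def)
  qed (auto simp: U_def represents_iff abs_set_def absorbable_def)
  also have "\<dots> = (\<Sum>F\<in>\<Delta>. (\<Prod>i\<in>F. x i) * (\<Prod>i\<in>U - F. 1 - x i))"
  proof (rule sum.reindex_cong[symmetric])
    show "\<Delta> = (\<lambda>P. U - P) ` ?\<P>"
      by (simp add: \<Delta>_def U_def subword_complex_eq)
    show "inj_on (\<lambda>P. U - P) ?\<P>" using P by (rule inj_on_inverseI)
  qed (simp add: P mult.commute)
  finally show ?thesis .
qed

lemma subword_complex_down_closed:
  assumes "F \<in> subword_complex G S Q g" "F' \<subseteq> F"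
  shows "F' \<in> subword_complex G S Q g"
proof -
  obtain P where P: "F = {..<length Q} - P" "contains G S Q P g"
    using assms by (auto simp: subword_complex_eq)
  then have "contains G S Q ({..<length Q} - F') g" "F' = {..<length Q} - ({..<length Q} - F')"
    using assms(2) unfolding contains_def by blast+
  then show ?thesis unfolding subword_complex_eq by blast
qed

end

theorem theorem4p4:
  fixes G :: "('a, 'b) monoid_scheme" and S :: "'a set" and Q :: "'a list" and \<pi> :: 'a
    and \<Delta> :: "nat set set"
  assumes "coxeter_system G S"
    and "set Q \<subseteq> S"
    and "\<pi> \<in> carrier G"
    and "\<Delta> = subword_complex G S Q \<pi>"
  shows "is_K_polynomial (length Q)
           (stanley_reisner_ideal (length Q) \<Delta> :: 'k::field mpoly set)
           (\<Sum>F\<in>facets \<Delta>.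
              let D = {..<length Q} - F
              in (\<Prod>i\<in>D. 1 - zvar i) * (\<Prod>i\<in>abs_set G S Q D. zvar i))"
proof -
  interpret group G using assms(1) by (simp add: coxeter_system_def)
  interpret subwords G S Q by unfold_locales (fact assms)+
  have "is_K_polynomial (length Q) (stanley_reisner_ideal (length Q) \<Delta> :: 'k mpoly set)
      (\<Sum>F\<in>\<Delta>. (\<Prod>i\<in>F. zvar i) * (\<Prod>i\<in>{..<length Q} - F. 1 - zvar i))"
    by (rule K_polynomial_of_complex)
      (auto simp: assms(4) subword_complex_eq intro: subword_complex_down_closed[unfolded subword_complex_eq])
  then show ?thesis
    using sum_facets_eq_sum_faces[OF assms(3), of "zvar :: nat \<Rightarrow> int mpoly"] by (simp add: Let_def assms(4))
qed

end
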